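(* Let $\Gamma$ be a finite simplicial graph that is connected, triangle-free, and has no separating vertices or edges, and assume that $\Gamma$ is either a join (i.e. a complete bipartite graph) or CFS. If the right-angled Coxeter group $W_\Gamma$ is infinite, then $W_\Gamma$ belongs to $\mathcal{G}_H$.
   Context: For a finite simplicial graph $\Gamma$ with vertex set $V$, $W_\Gamma$ is the group with generating set $V$ and relations $v^2=1$ for $v\in V$ and $vw=wv$ whenever $v$ and $w$ are connected by an edge in $\Gamma$. A vertex or edge of $\Gamma$ is separating if its complement in $\Gamma$ is not connected. The four-cycle graph $\Gamma^4$ has as vertices the embedded loops of length four (four-cycles) in $\Gamma$; two vertices of $\Gamma^4$ are connected by an edge if the corresponding four-cycles in $\Gamma$ share a pair of adjacent edges. The support of a subgraph $\Gamma_1$ of $\Gamma^4$ is the set of vertices of $\Gamma$ appearing in the four-cycles corresponding to the vertices of $\Gamma_1$. $\Gamma$ is CFS if some connected component of $\Gamma^4$ has support equal to the entire vertex set of $\Gamma$. For a finitely generated group $G$ fix a finite symmetric generating set $S$ with word length $\ell_S$, and let $B(n)=\{g\in G:\ell_S(g)\le n\}$. For a finite (discrete) set $A$, $G$ acts on $A^G$ (product topology) by $(gx)_h=x_{g^{-1}h}$. $\mathscr{G}_{inv}$ is the class of Polish groups admitting a compatible bi-invariant metric; for $H\in\mathscr{G}_{inv}$ fix such a (complete) metric $d$. A map $f:A^G\to H$ is H\"older continuous if there are $C>0$, $0<r<1$ such that for every $n\ge0$, $d(f(x),f(y))\le Cr^n$ for all $x,y$ with $x_{B(n)}=y_{B(n)}$.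 A cocycle $c:G\times A^G\to H$ is a map with $c(gh,x)=c(g,hx)c(h,x)$; it is H\"older continuous if $c(g,\cdot)$ is H\"older continuous for each $g$. Cocycles $c_1,c_2$ are H\"older cohomologous if there is a H\"older continuous $b:A^G\to H$ with $c_1(g,x)=b(gx)^{-1}c_2(g,x)b(x)$ for all $g,x$. $\mathcal{G}_H$ is the class of groups $G$ such that for every finite set $A$ and every $H\in\mathscr{G}_{inv}$, every H\"older continuous cocycle $c:G\times A^G\to H$ is H\"older cohomologous to a group homomorphism $G\to H$. *)

theory Defs
  imports
    "HOL-Analysis.Analysis"
    "HOL-Algebra.Generated_Groups"
    "Graph_Theory.Graph_Theory"
begin

text \<open>
  A finite simplicial graph is a \<open>pair_graph\<close> of \<open>Graph_Theory\<close>: finite, loop-free, and with each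
  undirected edge represented by its two arcs. Since topological connectedness is also in scope,
  connectedness of graphs is always written \<open>Digraph_Component.connected\<close>; for that notion the
  empty graph is not connected.
\<close>

section \<open>Group presentations and right-angled Coxeter groups\<close>

text \<open>
  The letter \<open>(s, True)\<close> stands for the generator \<open>s\<close>, and \<open>(s, False)\<close> for its formal inverse.
  A pair \<open>(l, r)\<close> in \<open>R\<close> is the relation \<open>l = r\<close>.
\<close>

definition signed_words :: "'s set \<Rightarrow> ('s \<times> bool) list set" where
  "signed_words S = lists (S \<times> UNIV)"

inductive_set presentation_rel ::
    "'s set \<Rightarrow> (('s \<times> bool) list \<times> ('s \<times> bool) list) set
      \<Rightarrow> (('s \<times> bool) list \<times> ('s \<times> bool) list) set"
  for S R where
    refl: "u \<in> signed_words S \<Longrightarrow> (u, u) \<in> presentation_rel S R"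
  | sym: "(u, w) \<in> presentation_rel S R \<Longrightarrow> (w, u) \<in> presentation_rel S R"
  | trans: "(u, w) \<in> presentation_rel S R \<Longrightarrow> (w, x) \<in> presentation_rel S R
      \<Longrightarrow> (u, x) \<in> presentation_rel S R"
  | cancel: "u \<in> signed_words S \<Longrightarrow> w \<in> signed_words S \<Longrightarrow> s \<in> S
      \<Longrightarrow> (u @ [(s, e), (s, \<not> e)] @ w, u @ w) \<in> presentation_rel S R"
  | relation: "u \<in> signed_words S \<Longrightarrow> w \<in> signed_words S
      \<Longrightarrow> l \<in> signed_words S \<Longrightarrow> r \<in> signed_words S \<Longrightarrow> (l, r) \<in> R
      \<Longrightarrow> (u @ l @ w, u @ r @ w) \<in> presentation_rel S R"

definition presented_group ::
    "'s set \<Rightarrow> (('s \<times> bool) list \<times> ('s \<times> bool) list) set \<Rightarrow> ('s \<times> bool) list set monoid" where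
  "presented_group S R =
    \<lparr> carrier = signed_words S // presentation_rel S R,
      mult = (\<lambda>X Y. \<Union>x\<in>X. \<Union>y\<in>Y. presentation_rel S R `` {x @ y}),
      one = presentation_rel S R `` {[]} \<rparr>"

definition racg :: "'v pair_pre_digraph \<Rightarrow> ('v \<times> bool) list set monoid" where
  "racg \<Gamma> = presented_group (pverts \<Gamma>)
     ({([(v, True), (v, True)], []) | v. v \<in> pverts \<Gamma>}
      \<union> {([(v, True), (w, True)], [(w, True), (v, True)]) | v w. (v, w) \<in> parcs \<Gamma>})"

lemma presentation_rel_words:
  "(u, w) \<in> presentation_rel S R \<Longrightarrow> u \<in> signed_words S \<and> w \<in> signed_words S"
  by (induction rule: presentation_rel.induct) (auto simp: signed_words_def)

lemma equiv_presentation_rel: "equiv (signed_words S) (presentation_rel S R)"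
proof (rule equivI)
  show "presentation_rel S R \<subseteq> signed_words S \<times> signed_words S"
    using presentation_rel_words by auto
  show "refl_on (signed_words S) (presentation_rel S R)"
    by (rule refl_onI) (rule presentation_rel.refl)
  show "sym_on UNIV (presentation_rel S R)"
    by (rule symI) (rule presentation_rel.sym)
  show "trans_on UNIV (presentation_rel S R)"
    by (rule transI) (rule presentation_rel.trans)
qed

lemma presentation_rel_append_left:
  assumes "(u, w) \<in> presentation_rel S R" and "x \<in> signed_words S"
  shows "(x @ u, x @ w) \<in> presentation_rel S R"
  using assms
proof (induction rule: presentation_rel.induct)
  case (cancel u w s e)
  then show ?case
    using presentation_rel.cancel[of "x @ u" S w s e R] by (simp add: signed_words_def)
next
  case (relation u w l r)
  then show ?case
    using presentation_rel.relation[of "x @ u" S w l r R] by (simp add: signed_words_def)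
next
  case (refl u)
  then have "x @ u \<in> signed_words S" by (simp add: signed_words_def)
  then show ?case by (rule presentation_rel.refl)
next
  case (sym u w)
  show ?case by (rule presentation_rel.sym) (rule sym.IH[OF sym.prems])
next
  case (trans u w y)
  show ?case
    by (rule presentation_rel.trans) (rule trans.IH(1)[OF trans.prems], rule trans.IH(2)[OF trans.prems])
qed

lemma presentation_rel_append_right:
  assumes "(u, w) \<in> presentation_rel S R" and "x \<in> signed_words S"
  shows "(u @ x, w @ x) \<in> presentation_rel S R"
  using assms
proof (induction rule: presentation_rel.induct)
  case (cancel u w s e)
  then show ?case
    using presentation_rel.cancel[of u S "w @ x" s e R] by (simp add: signed_words_def)
next
  case (relation u w l r)
  then show ?case
    using presentation_rel.relation[of u S "w @ x" l r R] by (simp add: signed_words_def)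
next
  case (refl u)
  then have "u @ x \<in> signed_words S" by (simp add: signed_words_def)
  then show ?case by (rule presentation_rel.refl)
next
  case (sym u w)
  show ?case by (rule presentation_rel.sym) (rule sym.IH[OF sym.prems])
next
  case (trans u w y)
  show ?case
    by (rule presentation_rel.trans) (rule trans.IH(1)[OF trans.prems], rule trans.IH(2)[OF trans.prems])
qed

lemma presentation_rel_append:
  assumes "(u, u') \<in> presentation_rel S R" and "(w, w') \<in> presentation_rel S R"
  shows "(u @ w, u' @ w') \<in> presentation_rel S R"
proof (rule presentation_rel.trans)
  show "(u @ w, u' @ w) \<in> presentation_rel S R"
    using presentation_rel_append_right[OF assms(1)] presentation_rel_words[OF assms(2)] by simp
  show "(u' @ w, u' @ w') \<in> presentation_rel S R"
    using presentation_rel_append_left[OF assms(2)] presentation_rel_words[OF assms(1)] by simp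
qed

lemma presented_group_mult:
  assumes "u \<in> signed_words S" and "w \<in> signed_words S"
  shows "presentation_rel S R `` {u} \<otimes>\<^bsub>presented_group S R\<^esub> presentation_rel S R `` {w}
    = presentation_rel S R `` {u @ w}"
proof -
  have eq: "presentation_rel S R `` {u' @ w'} = presentation_rel S R `` {u @ w}"
    if "(u, u') \<in> presentation_rel S R" "(w, w') \<in> presentation_rel S R" for u' w'
    using equiv_class_eq[OF equiv_presentation_rel presentation_rel_append[OF that]] by simp
  have self: "u \<in> presentation_rel S R `` {u}" "w \<in> presentation_rel S R `` {w}"
    using assms by (simp_all add: presentation_rel.refl)
  have "(\<Union>u'\<in>presentation_rel S R `` {u}. \<Union>w'\<in>presentation_rel S R `` {w}.
      presentation_rel S R `` {u' @ w'}) = presentation_rel S R `` {u @ w}"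
  proof (rule subset_antisym)
    show "(\<Union>u'\<in>presentation_rel S R `` {u}. \<Union>w'\<in>presentation_rel S R `` {w}.
        presentation_rel S R `` {u' @ w'}) \<subseteq> presentation_rel S R `` {u @ w}"
      by (intro UN_least) (simp only: Image_singleton_iff eq order_refl)
    show "presentation_rel S R `` {u @ w} \<subseteq>
        (\<Union>u'\<in>presentation_rel S R `` {u}. \<Union>w'\<in>presentation_rel S R `` {w}.
          presentation_rel S R `` {u' @ w'})"
      by (rule order_trans[OF UN_upper[OF self(2)] UN_upper[OF self(1)]])
  qed
  then show ?thesis
    by (simp only: presented_group_def monoid.simps)
qed

lemma presentation_rel_inverse:
  "u \<in> signed_words S \<Longrightarrow>
    (rev (map (\<lambda>(s, e). (s, \<not> e)) u) @ u, []) \<in> presentation_rel S R"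
proof (induction u)
  case Nil
  then show ?case by (auto intro: presentation_rel.refl)
next
  case (Cons a u)
  obtain s e where a: "a = (s, e)" by (cases a)
  let ?v = "rev (map (\<lambda>(s, e). (s, \<not> e)) u)"
  have u: "u \<in> signed_words S" and s: "s \<in> S"
    using Cons.prems a by (auto simp: signed_words_def)
  have v: "?v \<in> signed_words S"
    using u by (simp add: signed_words_def in_lists_conv_set mem_Times_iff split_beta)
  have "(?v @ [(s, \<not> e), (s, \<not> \<not> e)] @ u, ?v @ u) \<in> presentation_rel S R"
    by (rule presentation_rel.cancel[OF v u s])
  then have "(?v @ [(s, \<not> e), (s, \<not> \<not> e)] @ u, []) \<in> presentation_rel S R"
    using Cons.IH[OF u] by (rule presentation_rel.trans)
  then show ?case by (simp add: a)
qed

lemma group_presented_group: "group (presented_group S R)"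
proof (rule groupI)
  let ?P = "presented_group S R" and ?r = "presentation_rel S R"
  have car: "carrier ?P = signed_words S // ?r" and one: "\<one>\<^bsub>?P\<^esub> = ?r `` {[]}"
    by (auto simp: presented_group_def)
  have nil: "[] \<in> signed_words S" by (simp add: signed_words_def)
  have app: "u @ w \<in> signed_words S" if "u \<in> signed_words S" "w \<in> signed_words S" for u w
    using that by (simp add: signed_words_def)
  show "\<one>\<^bsub>?P\<^esub> \<in> carrier ?P"
    unfolding car one using nil by (rule quotientI)
  fix x assume "x \<in> carrier ?P"
  then obtain u where u: "u \<in> signed_words S" "x = ?r `` {u}"
    unfolding car by (rule quotientE)
  show "\<one>\<^bsub>?P\<^esub> \<otimes>\<^bsub>?P\<^esub> x = x"
    unfolding one u(2) using presented_group_mult[OF nil u(1)] by simp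
  let ?v = "rev (map (\<lambda>(s, e). (s, \<not> e)) u)"
  have v: "?v \<in> signed_words S"
    using u by (simp add: signed_words_def in_lists_conv_set mem_Times_iff split_beta)
  have "?r `` {?v} \<otimes>\<^bsub>?P\<^esub> x = \<one>\<^bsub>?P\<^esub>"
    unfolding u(2) presented_group_mult[OF v u(1)] one
    by (rule equiv_class_eq[OF equiv_presentation_rel presentation_rel_inverse[OF u(1)]])
  then show "\<exists>y\<in>carrier ?P. y \<otimes>\<^bsub>?P\<^esub> x = \<one>\<^bsub>?P\<^esub>"
    using quotientI[OF v] unfolding car by blast
  fix y assume "y \<in> carrier ?P"
  then obtain w where w: "w \<in> signed_words S" "y = ?r `` {w}"
    unfolding car by (rule quotientE)
  show "x \<otimes>\<^bsub>?P\<^esub> y \<in> carrier ?P"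
    unfolding u(2) w(2) presented_group_mult[OF u(1) w(1)] car
    by (rule quotientI[OF app[OF u(1) w(1)]])
  fix z assume "z \<in> carrier ?P"
  then obtain t where t: "t \<in> signed_words S" "z = ?r `` {t}"
    unfolding car by (rule quotientE)
  show "x \<otimes>\<^bsub>?P\<^esub> y \<otimes>\<^bsub>?P\<^esub> z = x \<otimes>\<^bsub>?P\<^esub> (y \<otimes>\<^bsub>?P\<^esub> z)"
    unfolding u(2) w(2) t(2)
    by (simp add: presented_group_mult u w t app)
qed

lemma group_racg: "group (racg \<Gamma>)"
  unfolding racg_def by (rule group_presented_group)


section \<open>Conditions on the defining graph\<close>

definition triangle_free :: "'v pair_pre_digraph \<Rightarrow> bool" where
  "triangle_free \<Gamma> \<longleftrightarrow>
     \<not> (\<exists>a b c. (a, b) \<in> parcs \<Gamma> \<and> (b, c) \<in> parcs \<Gamma> \<and> (c, a) \<in> parcs \<Gamma>)"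

definition separating_vertex :: "'v pair_pre_digraph \<Rightarrow> 'v \<Rightarrow> bool" where
  "separating_vertex \<Gamma> v \<longleftrightarrow> v \<in> pverts \<Gamma> \<and>
     \<not> Digraph_Component.connected (with_proj \<Gamma> \<restriction> (pverts \<Gamma> - {v}))"

text \<open>
  The complement of an edge is the complement of the closed edge: both endpoints are removed, with
  all edges meeting them.
\<close>

definition separating_edge :: "'v pair_pre_digraph \<Rightarrow> 'v \<Rightarrow> 'v \<Rightarrow> bool" where
  "separating_edge \<Gamma> v w \<longleftrightarrow> (v, w) \<in> parcs \<Gamma> \<and>
     \<not> Digraph_Component.connected (with_proj \<Gamma> \<restriction> (pverts \<Gamma> - {v, w}))"

definition complete_bipartite_graph :: "'v pair_pre_digraph \<Rightarrow> bool" where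
  "complete_bipartite_graph \<Gamma> \<longleftrightarrow>
     (\<exists>X Y. X \<noteq> {} \<and> Y \<noteq> {} \<and> X \<inter> Y = {} \<and> pverts \<Gamma> = X \<union> Y
        \<and> parcs \<Gamma> = X \<times> Y \<union> Y \<times> X)"

text \<open>A four-cycle is represented by its set of four undirected edges.\<close>

definition four_cycles :: "'v pair_pre_digraph \<Rightarrow> 'v set set set" where
  "four_cycles \<Gamma> = {{{a, b}, {b, c}, {c, d}, {d, a}} | a b c d. distinct [a, b, c, d]
     \<and> (a, b) \<in> parcs \<Gamma> \<and> (b, c) \<in> parcs \<Gamma> \<and> (c, d) \<in> parcs \<Gamma> \<and> (d, a) \<in> parcs \<Gamma>}"

definition four_cycle_graph :: "'v pair_pre_digraph \<Rightarrow> 'v set set pair_pre_digraph" where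
  "four_cycle_graph \<Gamma> =
    \<lparr> pverts = four_cycles \<Gamma>,
      parcs = {(C, D). C \<in> four_cycles \<Gamma> \<and> D \<in> four_cycles \<Gamma> \<and> C \<noteq> D
        \<and> (\<exists>e f. e \<in> C \<inter> D \<and> f \<in> C \<inter> D \<and> e \<noteq> f \<and> e \<inter> f \<noteq> {})} \<rparr>"

definition support :: "'v set set set \<Rightarrow> 'v set" where
  "support K = (\<Union>C\<in>K. \<Union>C)"

text \<open>
  The four-cycle graph is symmetric, so its strongly connected components are its connected
  components.
\<close>

definition CFS :: "'v pair_pre_digraph \<Rightarrow> bool" where
  "CFS \<Gamma> \<longleftrightarrow>
     (\<exists>K \<in> pre_digraph.sccs_verts (with_proj (four_cycle_graph \<Gamma>)). support K = pverts \<Gamma>)"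


section \<open>Polish groups with a bi-invariant metric\<close>

definition polish_group :: "('h, 'm) monoid_scheme \<Rightarrow> 'h topology \<Rightarrow> bool" where
  "polish_group H T \<longleftrightarrow> group H \<and> topspace T = carrier H
     \<and> continuous_map (prod_topology T T) T (\<lambda>(x, y). x \<otimes>\<^bsub>H\<^esub> y)
     \<and> continuous_map T T (\<lambda>x. inv\<^bsub>H\<^esub> x)
     \<and> completely_metrizable_space T \<and> separable_space T"

definition biinvariant_metric ::
    "('h, 'm) monoid_scheme \<Rightarrow> 'h topology \<Rightarrow> ('h \<Rightarrow> 'h \<Rightarrow> real) \<Rightarrow> bool" where
  "biinvariant_metric H T d \<longleftrightarrow>
     Metric_space (carrier H) d \<and> Metric_space.mtopology (carrier H) d = T
     \<and> (\<forall>g\<in>carrier H. \<forall>x\<in>carrier H. \<forall>y\<in>carrier H.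
          d (g \<otimes>\<^bsub>H\<^esub> x) (g \<otimes>\<^bsub>H\<^esub> y) = d x y \<and> d (x \<otimes>\<^bsub>H\<^esub> g) (y \<otimes>\<^bsub>H\<^esub> g) = d x y)"

definition G_inv :: "('h, 'm) monoid_scheme \<Rightarrow> 'h topology \<Rightarrow> bool" where
  "G_inv H T \<longleftrightarrow> polish_group H T \<and> (\<exists>d. biinvariant_metric H T d)"


section \<open>Cocycles over the full shift\<close>

definition symmetric_generating_set :: "('g, 'm) monoid_scheme \<Rightarrow> 'g set \<Rightarrow> bool" where
  "symmetric_generating_set G S \<longleftrightarrow>
     S \<subseteq> carrier G \<and> (\<forall>s\<in>S. inv\<^bsub>G\<^esub> s \<in> S) \<and> generate G S = carrier G"

definition word_length :: "('g, 'm) monoid_scheme \<Rightarrow> 'g set \<Rightarrow> 'g \<Rightarrow> nat" where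
  "word_length G S g =
     (LEAST n. \<exists>w. set w \<subseteq> S \<and> length w = n \<and> foldr (\<otimes>\<^bsub>G\<^esub>) w \<one>\<^bsub>G\<^esub> = g)"

definition word_ball :: "('g, 'm) monoid_scheme \<Rightarrow> 'g set \<Rightarrow> nat \<Rightarrow> 'g set" where
  "word_ball G S n = {g \<in> carrier G. word_length G S g \<le> n}"

definition full_shift :: "('g, 'm) monoid_scheme \<Rightarrow> 'a set \<Rightarrow> ('g \<Rightarrow> 'a) set" where
  "full_shift G A = carrier G \<rightarrow>\<^sub>E A"

definition shift_act :: "('g, 'm) monoid_scheme \<Rightarrow> 'g \<Rightarrow> ('g \<Rightarrow> 'a) \<Rightarrow> ('g \<Rightarrow> 'a)" where
  "shift_act G g x = (\<lambda>h\<in>carrier G. x (inv\<^bsub>G\<^esub> g \<otimes>\<^bsub>G\<^esub> h))"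

definition holder_continuous ::
    "('g, 'm) monoid_scheme \<Rightarrow> 'g set \<Rightarrow> 'a set \<Rightarrow> ('h, 'n) monoid_scheme \<Rightarrow> ('h \<Rightarrow> 'h \<Rightarrow> real)
      \<Rightarrow> (('g \<Rightarrow> 'a) \<Rightarrow> 'h) \<Rightarrow> bool" where
  "holder_continuous G S A H d f \<longleftrightarrow> f \<in> full_shift G A \<rightarrow> carrier H
     \<and> (\<exists>C r. 0 < C \<and> 0 < r \<and> r < 1
          \<and> (\<forall>n. \<forall>x\<in>full_shift G A. \<forall>y\<in>full_shift G A.
               (\<forall>h\<in>word_ball G S n. x h = y h) \<longrightarrow> d (f x) (f y) \<le> C * r ^ n))"

definition cocycle ::
    "('g, 'm) monoid_scheme \<Rightarrow> 'a set \<Rightarrow> ('h, 'n) monoid_scheme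
      \<Rightarrow> ('g \<Rightarrow> ('g \<Rightarrow> 'a) \<Rightarrow> 'h) \<Rightarrow> bool" where
  "cocycle G A H c \<longleftrightarrow>
     (\<forall>g\<in>carrier G. \<forall>x\<in>full_shift G A. c g x \<in> carrier H)
     \<and> (\<forall>g\<in>carrier G. \<forall>h\<in>carrier G. \<forall>x\<in>full_shift G A.
          c (g \<otimes>\<^bsub>G\<^esub> h) x = c g (shift_act G h x) \<otimes>\<^bsub>H\<^esub> c h x)"

definition holder_cocycle ::
    "('g, 'm) monoid_scheme \<Rightarrow> 'g set \<Rightarrow> 'a set \<Rightarrow> ('h, 'n) monoid_scheme \<Rightarrow> ('h \<Rightarrow> 'h \<Rightarrow> real)
      \<Rightarrow> ('g \<Rightarrow> ('g \<Rightarrow> 'a) \<Rightarrow> 'h) \<Rightarrow> bool" where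
  "holder_cocycle G S A H d c \<longleftrightarrow>
     cocycle G A H c \<and> (\<forall>g\<in>carrier G. holder_continuous G S A H d (c g))"

definition holder_cohomologous ::
    "('g, 'm) monoid_scheme \<Rightarrow> 'g set \<Rightarrow> 'a set \<Rightarrow> ('h, 'n) monoid_scheme \<Rightarrow> ('h \<Rightarrow> 'h \<Rightarrow> real)
      \<Rightarrow> ('g \<Rightarrow> ('g \<Rightarrow> 'a) \<Rightarrow> 'h) \<Rightarrow> ('g \<Rightarrow> ('g \<Rightarrow> 'a) \<Rightarrow> 'h) \<Rightarrow> bool" where
  "holder_cohomologous G S A H d c1 c2 \<longleftrightarrow>
     (\<exists>b. holder_continuous G S A H d b
        \<and> (\<forall>g\<in>carrier G. \<forall>x\<in>full_shift G A.
             c1 g x = inv\<^bsub>H\<^esub> (b (shift_act G g x)) \<otimes>\<^bsub>H\<^esub> c2 g x \<otimes>\<^bsub>H\<^esub> b x))"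

text \<open>
  Membership in the class of finitely generated groups all of whose Hoelder cocycles over full
  shifts, with values in groups from \<open>G_inv\<close>, are Hoelder cohomologous to homomorphisms.
  HOL cannot quantify over types inside a definition, so the types of the alphabet \<open>A\<close> and of the
  elements of \<open>H\<close> are parameters; a theorem with free type variables there covers all of them. The
  choices of the generating set \<open>S\<close> and of the complete metric \<open>d\<close> are arbitrary, so both are
  universally quantified.
\<close>

definition class_G_H :: "'a itself \<Rightarrow> 'h itself \<Rightarrow> ('g, 'm) monoid_scheme \<Rightarrow> bool" where
  "class_G_H (_ :: 'a itself) (_ :: 'h itself) G \<longleftrightarrow>
     group G \<and> (\<exists>S. finite S \<and> symmetric_generating_set G S)
     \<and> (\<forall>S (A :: 'a set) (H :: 'h monoid) T d c.
          finite S \<and> symmetric_generating_set G S \<and> finite A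
          \<and> G_inv H T \<and> biinvariant_metric H T d \<and> Metric_space.mcomplete (carrier H) d
          \<and> holder_cocycle G S A H d c
          \<longrightarrow> (\<exists>\<phi>\<in>hom G H. holder_cohomologous G S A H d c (\<lambda>g x. \<phi> g)))"

end

theory Submission
  imports Defs
begin

text \<open>
  For an element \<open>g\<close> of linear growth and configurations \<open>x\<close>, \<open>y\<close> that differ at finitely many sites,
  \<open>c(g\<^sup>n,x)\<inverse> c(g\<^sup>n,y)\<close> converges to some \<open>\<tau>\<^sub>g(x,y)\<close>, because \<open>g\<^sup>n\<close> carries the difference set away from the
  identity at linear speed. If \<open>g\<close> and \<open>k\<close> commute and span an undistorted quadrant, then walking
  from \<open>g\<^sup>n\<close> to \<open>g\<^sup>n k\<^sup>n\<close> to \<open>k\<^sup>n\<close> stays far from the identity, so \<open>\<tau>\<^sub>g = \<tau>\<^sub>k\<close>. In \<open>W\<^sub>\<Gamma>\<close> a four-cycle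
  \<open>a b c d\<close> gives such a pair \<open>ac\<close>, \<open>bd\<close>; adjacent four-cycles share a diagonal, so under CFS one \<open>\<tau>\<close>
  serves all diagonals of a component, and every vertex \<open>v\<close> lies on such a diagonal \<open>{v,w}\<close>. Since
  \<open>v(vw)v\<inverse> = wv\<close> is again one of these elements, \<open>\<tau>(vx,vy) = c(v,x) \<tau>(x,y) c(v,y)\<inverse>\<close>. With \<open>x\<^sub>0\<close> constant,
  \<open>b(y) = \<tau>(x\<^sub>0,y)\<close>, extended by continuity, conjugates \<open>c\<close> to the homomorphism \<open>h \<mapsto> c(h,x\<^sub>0)\<close>.
\<close>

section \<open>Word lengths\<close>

text \<open>The shape of the proof is dictated by the extension by continuity. The rate at which the
  ratios along \<open>g [^] n\<close> converge depends on how far out \<open>x\<close> and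
  \<open>y\<close> differ: a site near the backward ray of \<open>g\<close> is carried back towards
  the identity at a late time. So the mere existence of \<open>tau\<close> gives no modulus of
  continuity. The remedy is that \<open>tau\<close> can also be computed along the inverse of
  \<open>g\<close>: in a square the direction \<open>bd\<close> spans an undistorted quadrant with
  \<open>ac\<close> and another one with its inverse \<open>ca\<close>, so all three have the same
  limits, and no site is near both rays of \<open>g\<close>. That the quadrants are undistorted is
  seen without normal forms, by folding the group onto an infinite dihedral group once for each
  diagonal. This requires opposite vertices of a square to be non-adjacent, which is where
  triangle-freeness enters. For a join, the absence of separating vertices and edges puts two
  vertices on each side; then the join consists of squares and is covered by the same chains of
  diagonals as in the CFS case.\<close>

locale fg_group = group G for G (structure) +
  fixes S :: "'a set"
  assumes finite_S: "finite S" and gen_S: "symmetric_generating_set G S"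
begin

abbreviation len :: "'a \<Rightarrow> nat" where
  "len g \<equiv> word_length G S g"

lemma S_carrier: "S \<subseteq> carrier G"
  using gen_S by (simp add: symmetric_generating_set_def)

lemma foldr_mult_closed: "set w \<subseteq> carrier G \<Longrightarrow> foldr (\<otimes>) w \<one> \<in> carrier G"
  by (induction w) auto

lemma foldr_mult_append:
  "set u \<subseteq> carrier G \<Longrightarrow> set w \<subseteq> carrier G \<Longrightarrow>
     foldr (\<otimes>) (u @ w) \<one> = foldr (\<otimes>) u \<one> \<otimes> foldr (\<otimes>) w \<one>"
  by (induction u) (auto simp: foldr_mult_closed m_assoc simp del: foldr_append)

lemma inv_foldr_mult:
  "set w \<subseteq> carrier G \<Longrightarrow> inv (foldr (\<otimes>) w \<one>) = foldr (\<otimes>) (rev (map (\<lambda>s. inv s) w)) \<one>"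
proof (induction w)
  case (Cons s w)
  have "set (rev (map (\<lambda>s. inv s) w)) \<subseteq> carrier G"
    using Cons.prems by auto
  then show ?case
    using Cons by (simp add: foldr_mult_append inv_mult_group foldr_mult_closed del: foldr_append)
qed simp

lemma ex_word: "g \<in> carrier G \<Longrightarrow> \<exists>w. set w \<subseteq> S \<and> foldr (\<otimes>) w \<one> = g"
proof -
  assume "g \<in> carrier G"
  then have "g \<in> generate G S"
    using gen_S by (simp add: symmetric_generating_set_def)
  then show ?thesis
  proof (induction rule: generate.induct)
    case one
    show ?case by (rule exI[of _ "[]"]) simp
  next
    case (incl h)
    then show ?case
      using S_carrier by (intro exI[of _ "[h]"]) auto
  next
    case (inv h)
    then show ?case
      using S_carrier gen_S
      by (intro exI[of _ "[inv\<^bsub>G\<^esub> h]"]) (auto simp: symmetric_generating_set_def)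
  next
    case (eng h1 h2)
    then obtain u w where "set u \<subseteq> S" "foldr (\<otimes>) u \<one> = h1" "set w \<subseteq> S" "foldr (\<otimes>) w \<one> = h2"
      by blast
    then show ?case
      using S_carrier by (intro exI[of _ "u @ w"]) (auto simp: foldr_mult_append simp del: foldr_append)
  qed
qed

lemma len_word:
  assumes "g \<in> carrier G"
  obtains w where "set w \<subseteq> S" "length w = len g" "foldr (\<otimes>) w \<one> = g"
proof -
  have "\<exists>n. \<exists>w. set w \<subseteq> S \<and> length w = n \<and> foldr (\<otimes>) w \<one> = g"
    using ex_word[OF assms] by blast
  then have "\<exists>w. set w \<subseteq> S \<and> length w = len g \<and> foldr (\<otimes>) w \<one> = g"
    unfolding word_length_def by (rule LeastI_ex)
  then show ?thesis
    using that by blast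
qed

lemma len_foldr_le: "set w \<subseteq> S \<Longrightarrow> len (foldr (\<otimes>) w \<one>) \<le> length w"
  unfolding word_length_def by (rule Least_le) blast

lemma len_mult_le:
  assumes "g \<in> carrier G" "h \<in> carrier G"
  shows "len (g \<otimes> h) \<le> len g + len h"
proof -
  obtain u where u: "set u \<subseteq> S" "length u = len g" "foldr (\<otimes>) u \<one> = g"
    using len_word[OF assms(1)] .
  obtain w where w: "set w \<subseteq> S" "length w = len h" "foldr (\<otimes>) w \<one> = h"
    using len_word[OF assms(2)] .
  show ?thesis
    using len_foldr_le[of "u @ w"] foldr_mult_append[of u w] u w S_carrier by auto
qed

lemma len_inv_le:
  assumes "g \<in> carrier G"
  shows "len (inv g) \<le> len g"
proof -
  obtain u where u: "set u \<subseteq> S" "length u = len g" "foldr (\<otimes>) u \<one> = g"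
    using len_word[OF assms(1)] .
  have "set (rev (map (\<lambda>s. inv s) u)) \<subseteq> S"
    using u gen_S by (auto simp: symmetric_generating_set_def)
  from len_foldr_le[OF this] show ?thesis
    using inv_foldr_mult[of u] u S_carrier by simp
qed

lemma len_inv: "g \<in> carrier G \<Longrightarrow> len (inv g) = len g"
  using len_inv_le[of g] len_inv_le[of "inv g"] by simp

lemma len_one [simp]: "len \<one> = 0"
  using len_foldr_le[of "[]"] by simp

lemma len_eq_0: "g \<in> carrier G \<Longrightarrow> len g = 0 \<longleftrightarrow> g = \<one>"
  by (metis foldr.simps(1) id_apply len_one len_word length_0_conv)

lemma finite_word_ball: "finite (word_ball G S n)"
proof (rule finite_subset)
  show "word_ball G S n \<subseteq> (\<lambda>w. foldr (\<otimes>) w \<one>) ` {w. set w \<subseteq> S \<and> length w \<le> n}"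
  proof
    fix g assume "g \<in> word_ball G S n"
    then have "g \<in> carrier G" "len g \<le> n" by (auto simp: word_ball_def)
    moreover obtain w where "set w \<subseteq> S" "length w = len g" "foldr (\<otimes>) w \<one> = g"
      using len_word[OF \<open>g \<in> carrier G\<close>] .
    ultimately show "g \<in> (\<lambda>w. foldr (\<otimes>) w \<one>) ` {w. set w \<subseteq> S \<and> length w \<le> n}"
      by (intro image_eqI[of _ _ w]) auto
  qed
  show "finite ((\<lambda>w. foldr (\<otimes>) w \<one>) ` {w. set w \<subseteq> S \<and> length w \<le> n})"
    using finite_S by (intro finite_imageI finite_lists_length_le)
qed

text \<open>Right multiplication by \<open>k\<close> moves every point by \<open>len k\<close> in
  the left-invariant word metric. A bounded set of sites therefore cannot spoil linear
  growth.\<close>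

lemma len_translate_ge:
  assumes "g \<in> carrier G" "k \<in> carrier G"
  shows "real (len g) - len k \<le> len (g \<otimes> k)"
proof -
  have "g = (g \<otimes> k) \<otimes> inv k"
    using assms by (simp add: m_assoc)
  then have "len g \<le> len (g \<otimes> k) + len k"
    by (metis assms inv_closed len_inv len_mult_le m_closed)
  then show ?thesis by simp
qed

lemma len_le_translate:
  assumes "g \<in> carrier G" "k \<in> carrier G"
  shows "len k \<le> len g + len (g \<otimes> k)"
proof -
  have "inv g \<otimes> (g \<otimes> k) = k"
    using assms by (simp add: m_assoc[symmetric])
  then show ?thesis
    using len_mult_le[of "inv g" "g \<otimes> k"] assms by (simp add: len_inv)
qed

lemma len_pow_le:
  assumes "g \<in> carrier G"
  shows "len (g [^] (n::nat)) \<le> n * len g"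
proof (induction n)
  case (Suc n)
  then show ?case
    using len_mult_le[of "g [^] n" g] assms by simp
qed simp

text \<open>This moves \<open>v\<close> to the left of a power, where \<open>ratio_step\<close> can
  discard it: left multiplication by a fixed element is cheap far from the identity.\<close>

lemma pow_conjugate:
  assumes "g \<in> carrier G" "v \<in> carrier G"
  shows "g [^] (n::nat) \<otimes> v = v \<otimes> (inv v \<otimes> g \<otimes> v) [^] n"
proof (induction n)
  case (Suc n)
  have "g \<otimes> v = v \<otimes> (inv v \<otimes> g \<otimes> v)"
    using assms by (simp add: m_assoc[symmetric])
  then have "g [^] Suc n \<otimes> v = g [^] n \<otimes> v \<otimes> (inv v \<otimes> g \<otimes> v)"
    using assms by (simp add: m_assoc)
  also have "\<dots> = v \<otimes> (inv v \<otimes> g \<otimes> v) [^] Suc n"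
    unfolding Suc using assms by (simp add: m_assoc)
  finally show ?case .
qed (use assms in simp)

text \<open>A subadditive function is bounded on the finite set of generators and so grows at most
  linearly along words. It turns any test function on the group into a lower bound for
  \<open>len\<close>, for an arbitrary generating set.\<close>

lemma subadditive_le_len:
  fixes f :: "'a \<Rightarrow> nat"
  assumes "\<And>g h. g \<in> carrier G \<Longrightarrow> h \<in> carrier G \<Longrightarrow> f (g \<otimes> h) \<le> f g + f h" and "f \<one> = 0"
  obtains \<epsilon> :: real where "0 < \<epsilon>" "\<And>g. g \<in> carrier G \<Longrightarrow> \<epsilon> * f g \<le> len g"
proof -
  \<comment> \<open>\<open>Suc\<close> keeps \<open>L\<close> positive even if \<open>f\<close>
    vanishes on all generators, so that \<open>1 / L\<close> can serve as
    \<open>\<epsilon>\<close>.\<close>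
  define L where "L = Suc (\<Sum>s\<in>S. f s)"
  have L: "f s \<le> L" if "s \<in> S" for s
    using member_le_sum[of s S f] that finite_S by (simp add: L_def)
  have le: "f (foldr (\<otimes>) w \<one>) \<le> L * length w" if "set w \<subseteq> S" for w
    using that
  proof (induction w)
    case (Cons s w)
    then have "f (s \<otimes> foldr (\<otimes>) w \<one>) \<le> f s + f (foldr (\<otimes>) w \<one>)"
      using S_carrier foldr_mult_closed[of w] by (intro assms(1)) auto
    then show ?case
      using Cons L[of s] by simp
  qed (simp add: assms(2))
  have "1 / L * f g \<le> len g" if g: "g \<in> carrier G" for g
  proof -
    obtain w where "set w \<subseteq> S" "length w = len g" "foldr (\<otimes>) w \<one> = g"
      using len_word[OF g] .
    then have "f g \<le> L * len g"
      using le[of w] by simp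
    then have "real (f g) \<le> real L * real (len g)"
      by (metis of_nat_le_iff of_nat_mult)
    moreover have "0 < real L"
      by (simp add: L_def del: of_nat_Suc)
    ultimately show ?thesis
      by (simp add: field_simps)
  qed
  moreover have "0 < 1 / real L"
    by (simp add: L_def del: of_nat_Suc)
  ultimately show ?thesis
    using that by blast
qed

end

section \<open>Convergence in groups with a complete bi-invariant metric\<close>

locale biinvariant_group = group H + Metric_space "carrier H" d for H (structure) and d +
  assumes left_invariant:
      "\<lbrakk>g \<in> carrier H; x \<in> carrier H; y \<in> carrier H\<rbrakk> \<Longrightarrow> d (g \<otimes> x) (g \<otimes> y) = d x y"
    and right_invariant:
      "\<lbrakk>g \<in> carrier H; x \<in> carrier H; y \<in> carrier H\<rbrakk> \<Longrightarrow> d (x \<otimes> g) (y \<otimes> g) = d x y"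
    and complete: "mcomplete"
begin

lemma dist_mult_le:
  assumes "x \<in> carrier H" "y \<in> carrier H" "x' \<in> carrier H" "y' \<in> carrier H"
  shows "d (x \<otimes> y) (x' \<otimes> y') \<le> d x x' + d y y'"
  using triangle[of "x \<otimes> y" "x' \<otimes> y" "x' \<otimes> y'"] assms
  by (simp add: left_invariant right_invariant)

text \<open>Convergence is reduced to a real null sequence of distances, so that every limit
  argument becomes a comparison of real sequences.\<close>

definition conv :: "(nat \<Rightarrow> 'a) \<Rightarrow> 'a \<Rightarrow> bool" where
  "conv u l \<longleftrightarrow> range u \<subseteq> carrier H \<and> l \<in> carrier H \<and> (\<lambda>n. d (u n) l) \<longlonglongrightarrow> 0"

lemma conv_carrier:
  assumes "conv u l"
  shows "u n \<in> carrier H" "l \<in> carrier H"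
  using assms by (auto simp: conv_def)

lemma conv_const: "l \<in> carrier H \<Longrightarrow> conv (\<lambda>_. l) l"
  by (simp add: conv_def)

lemma conv_asymp:
  assumes "conv u l" "range v \<subseteq> carrier H" "(\<lambda>n. d (u n) (v n)) \<longlonglongrightarrow> 0"
  shows "conv v l"
proof -
  have "(\<lambda>n. d (v n) l) \<longlonglongrightarrow> 0"
  proof (rule tendsto_sandwich)
    show "\<forall>\<^sub>F n in sequentially. 0 \<le> d (v n) l" by simp
    show "\<forall>\<^sub>F n in sequentially. d (v n) l \<le> d (u n) (v n) + d (u n) l"
    proof (intro always_eventually allI)
      fix n
      have "u n \<in> carrier H" "v n \<in> carrier H" "l \<in> carrier H"
        using assms by (auto simp: conv_def)
      then show "d (v n) l \<le> d (u n) (v n) + d (u n) l"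
        using triangle[of "v n" "u n" l] by (simp add: commute)
    qed
    show "(\<lambda>n. d (u n) (v n) + d (u n) l) \<longlonglongrightarrow> 0"
      using tendsto_add[OF assms(3), of "\<lambda>n. d (u n) l" 0] assms(1) by (simp add: conv_def)
  qed simp
  then show ?thesis
    using assms by (simp add: conv_def)
qed

lemma conv_dist:
  assumes "conv u l" "conv v m"
  shows "(\<lambda>n. d (u n) (v n)) \<longlonglongrightarrow> d l m"
proof -
  have "(\<lambda>n. d (u n) (v n) - d l m) \<longlonglongrightarrow> 0"
  proof (rule Lim_null_comparison)
    show "\<forall>\<^sub>F n in sequentially. norm (d (u n) (v n) - d l m) \<le> d (u n) l + d (v n) m"
    proof (intro always_eventually allI)
      fix n
      have "u n \<in> carrier H" "v n \<in> carrier H" "l \<in> carrier H" "m \<in> carrier H"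
        using assms by (auto simp: conv_def)
      then have "d (u n) (v n) \<le> d (u n) l + d l m + d (v n) m"
        "d l m \<le> d (u n) l + d (u n) (v n) + d (v n) m"
        using triangle[of "u n" l "v n"] triangle[of l m "v n"] triangle[of l "u n" m]
          triangle[of "u n" "v n" m] by (simp_all add: commute)
      then show "norm (d (u n) (v n) - d l m) \<le> d (u n) l + d (v n) m"
        by simp
    qed
    show "(\<lambda>n. d (u n) l + d (v n) m) \<longlonglongrightarrow> 0"
      using tendsto_add[of "\<lambda>n. d (u n) l" 0 _ "\<lambda>n. d (v n) m" 0] assms by (simp add: conv_def)
  qed
  then show ?thesis
    by (simp add: LIM_zero_iff)
qed

lemma conv_unique: "conv u l \<Longrightarrow> conv u m \<Longrightarrow> l = m"
  using conv_dist[of u l u m] by (simp add: conv_carrier LIMSEQ_const_iff)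

lemma conv_mult:
  assumes "conv u l" "conv v m"
  shows "conv (\<lambda>n. u n \<otimes> v n) (l \<otimes> m)"
proof -
  have cl: "u n \<in> carrier H" "v n \<in> carrier H" "l \<in> carrier H" "m \<in> carrier H" for n
    using assms by (auto simp: conv_def)
  have "(\<lambda>n. d (u n \<otimes> v n) (l \<otimes> m)) \<longlonglongrightarrow> 0"
  proof (rule tendsto_sandwich)
    show "\<forall>\<^sub>F n in sequentially. 0 \<le> d (u n \<otimes> v n) (l \<otimes> m)"
      by simp
    show "\<forall>\<^sub>F n in sequentially. d (u n \<otimes> v n) (l \<otimes> m) \<le> d (u n) l + d (v n) m"
      using cl by (intro always_eventually allI dist_mult_le) auto
    show "(\<lambda>n. d (u n) l + d (v n) m) \<longlonglongrightarrow> 0"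
      using tendsto_add[of "\<lambda>n. d (u n) l" 0 _ "\<lambda>n. d (v n) m" 0] assms by (simp add: conv_def)
  qed simp_all
  then show ?thesis
    using cl by (auto simp: conv_def)
qed

lemma geometric_conv:
  fixes C \<mu> :: real
  assumes "range u \<subseteq> carrier H" and "0 < \<mu>"
    and step: "\<And>n. d (u (Suc n)) (u n) \<le> C * exp (- \<mu> * n)"
  shows "\<exists>l. conv u l"
proof -
  define r where "r = exp (- \<mu>)"
  have r: "0 < r" "r < 1"
    using assms by (auto simp: r_def)
  have pow: "exp (- \<mu> * n) = r ^ n" for n :: nat
    by (simp add: r_def exp_of_nat_mult[symmetric] mult.commute)
  have C: "0 \<le> C"
    using order_trans[OF nonneg step[of 0]] by simp
  have un: "u n \<in> carrier H" for n
    using assms by auto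
  have tail: "d (u (n + k)) (u n) \<le> C * r ^ n / (1 - r)" for n k
  proof -
    \<comment> \<open>The exact partial sum of the geometric series is carried through the
      induction; the final bound \<open>C * r ^ n / (1 - r)\<close> is not inductive by
      itself.\<close>
    have "d (u (n + k)) (u n) \<le> C * r ^ n * (1 - r ^ k) / (1 - r)"
    proof (induction k)
      case (Suc k)
      have "d (u (n + Suc k)) (u n) \<le> d (u (Suc (n + k))) (u (n + k)) + d (u (n + k)) (u n)"
        using triangle un by simp
      also have "\<dots> \<le> C * r ^ (n + k) + C * r ^ n * (1 - r ^ k) / (1 - r)"
        using Suc step[of "n + k"] unfolding pow by (intro add_mono)
      also have "\<dots> = C * r ^ n * (1 - r ^ Suc k) / (1 - r)"
        using r by (simp add: field_simps power_add)
      finally show ?case .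
    qed (use un in simp)
    also have "\<dots> \<le> C * r ^ n / (1 - r)"
      using r C by (intro divide_right_mono mult_left_le) auto
    finally show ?thesis .
  qed
  have "MCauchy u"
    unfolding MCauchy_def
  proof (intro conjI allI impI)
    show "range u \<subseteq> carrier H" by fact
    fix e :: real assume "0 < e"
    have "(\<lambda>n. C * r ^ n / (1 - r)) \<longlonglongrightarrow> C * 0 / (1 - r)"
      using r by (intro tendsto_intros LIMSEQ_realpow_zero) auto
    then have "(\<lambda>n. C * r ^ n / (1 - r)) \<longlonglongrightarrow> 0" by simp
    then have "\<forall>\<^sub>F n in sequentially. C * r ^ n / (1 - r) < e / 2"
      by (rule order_tendstoD(2)) (use \<open>0 < e\<close> in simp)
    then obtain N where N: "C * r ^ N / (1 - r) < e / 2"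
      unfolding eventually_sequentially by blast
    have "d (u n) (u n') < e" if "N \<le> n" "N \<le> n'" for n n'
    proof -
      have "d (u n) (u N) \<le> C * r ^ N / (1 - r)" "d (u n') (u N) \<le> C * r ^ N / (1 - r)"
        using tail[of N "n - N"] tail[of N "n' - N"] that by simp_all
      moreover have "d (u n) (u n') \<le> d (u n) (u N) + d (u n') (u N)"
        using triangle[of "u n" "u N" "u n'"] un by (simp add: commute)
      ultimately show ?thesis
        using N by linarith
    qed
    then show "\<exists>N. \<forall>n n'. N \<le> n \<longrightarrow> N \<le> n' \<longrightarrow> d (u n) (u n') < e"
      by blast
  qed
  then obtain l where l: "limitin mtopology u l sequentially"
    using complete by (auto simp: mcomplete_def)
  then have "conv u l"
    using un by (auto simp: conv_def limitin_metric_dist_null)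
  then show ?thesis by blast
qed

end

section \<open>Cocycles along directions of linear growth\<close>

locale shift_cocycle = fg_group G S + H: biinvariant_group H d
  for G :: "('g, 'm) monoid_scheme" (structure) and S
    and H :: "('h, 'n) monoid_scheme" and d +
  fixes A :: "'a set" and c :: "'g \<Rightarrow> ('g \<Rightarrow> 'a) \<Rightarrow> 'h"
  assumes finite_A: "finite A" and holder: "holder_cocycle G S A H d c"
begin

abbreviation X :: "('g \<Rightarrow> 'a) set" where
  "X \<equiv> full_shift G A"

abbreviation act :: "'g \<Rightarrow> ('g \<Rightarrow> 'a) \<Rightarrow> 'g \<Rightarrow> 'a" where
  "act \<equiv> shift_act G"

definition diff :: "('g \<Rightarrow> 'a) \<Rightarrow> ('g \<Rightarrow> 'a) \<Rightarrow> 'g set" where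
  "diff x y = {k \<in> carrier G. x k \<noteq> y k}"

definition homoclinic :: "('g \<Rightarrow> 'a) \<Rightarrow> ('g \<Rightarrow> 'a) \<Rightarrow> bool" where
  "homoclinic x y \<longleftrightarrow> x \<in> X \<and> y \<in> X \<and> finite (diff x y)"

text \<open>If \<open>c\<close> is conjugate to a homomorphism by \<open>b\<close>, this is
  \<open>b x\<close> inverse times \<open>b y\<close>, up to a factor in the middle that compares
  \<open>b (act g x)\<close> with \<open>b (act g y)\<close>. That factor tends to the identity when
  \<open>g\<close> carries the differences away, so the limits of ratios are the only candidates for
  the transfer function.\<close>

definition ratio :: "'g \<Rightarrow> ('g \<Rightarrow> 'a) \<Rightarrow> ('g \<Rightarrow> 'a) \<Rightarrow> 'h" where
  "ratio g x y = inv\<^bsub>H\<^esub> c g x \<otimes>\<^bsub>H\<^esub> c g y"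

text \<open>Equivalently, \<open>g\<close> generates an undistorted infinite cyclic
  subgroup.\<close>

definition direction :: "'g \<Rightarrow> bool" where
  "direction g \<longleftrightarrow> g \<in> carrier G \<and> (\<exists>\<epsilon>>0. \<forall>n::nat. \<epsilon> * real n \<le> len (g [^] n))"

text \<open>Equality of limits along two elements, phrased so that it makes sense before any limit
  is known to exist and composes by the triangle inequality.\<close>

definition asymp :: "'g \<Rightarrow> 'g \<Rightarrow> bool" where
  "asymp g k \<longleftrightarrow> (\<forall>x y. homoclinic x y \<longrightarrow>
     (\<lambda>n::nat. d (ratio (g [^] n) x y) (ratio (k [^] n) x y)) \<longlonglongrightarrow> 0)"

section \<open>Algebra of the cocycle and its ratios\<close>

lemma c_closed [simp]: "g \<in> carrier G \<Longrightarrow> x \<in> X \<Longrightarrow> c g x \<in> carrier H"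
  using holder by (auto simp: holder_cocycle_def cocycle_def)

lemma c_mult:
  "g \<in> carrier G \<Longrightarrow> h \<in> carrier G \<Longrightarrow> x \<in> X \<Longrightarrow> c (g \<otimes> h) x = c g (act h x) \<otimes>\<^bsub>H\<^esub> c h x"
  using holder by (auto simp: holder_cocycle_def cocycle_def)

lemma act_closed [simp]: "g \<in> carrier G \<Longrightarrow> x \<in> X \<Longrightarrow> act g x \<in> X"
  by (auto simp: full_shift_def shift_act_def)

lemma act_apply: "k \<in> carrier G \<Longrightarrow> act g x k = x (inv g \<otimes> k)"
  by (simp add: shift_act_def)

lemma act_one [simp]:
  assumes "x \<in> X"
  shows "act \<one> x = x"
proof
  fix k
  show "act \<one> x k = x k"
    using assms by (cases "k \<in> carrier G") (auto simp: full_shift_def shift_act_def)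
qed

lemma act_mult:
  assumes "g \<in> carrier G" "h \<in> carrier G"
  shows "act (g \<otimes> h) x = act g (act h x)"
proof
  fix k
  show "act (g \<otimes> h) x k = act g (act h x) k"
    using assms by (auto simp: shift_act_def inv_mult_group m_assoc)
qed

lemma c_one [simp]:
  assumes "x \<in> X"
  shows "c \<one> x = \<one>\<^bsub>H\<^esub>"
proof -
  have "c \<one> x = c \<one> x \<otimes>\<^bsub>H\<^esub> c \<one> x"
    using c_mult[of \<one> \<one> x] assms by simp
  then show ?thesis
    using assms by (metis H.l_cancel_one' c_closed one_closed)
qed

lemma ratio_closed [simp]: "g \<in> carrier G \<Longrightarrow> x \<in> X \<Longrightarrow> y \<in> X \<Longrightarrow> ratio g x y \<in> carrier H"
  by (simp add: ratio_def)

lemma ratio_one: "x \<in> X \<Longrightarrow> y \<in> X \<Longrightarrow> ratio \<one> x y = \<one>\<^bsub>H\<^esub>"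
  by (simp add: ratio_def)

lemma ratio_mult:
  assumes "g \<in> carrier G" "x \<in> X" "y \<in> X" "z \<in> X"
  shows "ratio g x y \<otimes>\<^bsub>H\<^esub> ratio g y z = ratio g x z"
proof -
  have "ratio g x y \<otimes>\<^bsub>H\<^esub> ratio g y z
      = inv\<^bsub>H\<^esub> c g x \<otimes>\<^bsub>H\<^esub> (c g y \<otimes>\<^bsub>H\<^esub> inv\<^bsub>H\<^esub> c g y) \<otimes>\<^bsub>H\<^esub> c g z"
    using assms by (simp only: ratio_def H.m_assoc H.inv_closed H.m_closed c_closed)
  then show ?thesis
    using assms by (simp add: ratio_def)
qed

lemma ratio_cocycle:
  assumes "g \<in> carrier G" "h \<in> carrier G" "x \<in> X" "y \<in> X"
  shows "ratio (h \<otimes> g) x y = inv\<^bsub>H\<^esub> c g x \<otimes>\<^bsub>H\<^esub> ratio h (act g x) (act g y) \<otimes>\<^bsub>H\<^esub> c g y"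
  using assms by (simp add: ratio_def c_mult H.inv_mult_group H.m_assoc)

text \<open>Bi-invariance strips the outer factors \<open>c g x\<close> and \<open>c g y\<close>
  from \<open>ratio_cocycle\<close>, however far from the identity they are. No control over the
  growth of \<open>c\<close> along powers is ever needed.\<close>

lemma dist_ratio_mult:
  assumes "g \<in> carrier G" "h \<in> carrier G" "x \<in> X" "y \<in> X"
  shows "d (ratio (h \<otimes> g) x y) (ratio g x y) = d (c h (act g x)) (c h (act g y))"
proof -
  let ?a = "c h (act g x)" and ?a' = "c h (act g y)"
  have "d (ratio (h \<otimes> g) x y) (ratio g x y)
      = d (inv\<^bsub>H\<^esub> c g x \<otimes>\<^bsub>H\<^esub> (inv\<^bsub>H\<^esub> ?a \<otimes>\<^bsub>H\<^esub> ?a') \<otimes>\<^bsub>H\<^esub> c g y) (inv\<^bsub>H\<^esub> c g x \<otimes>\<^bsub>H\<^esub> \<one>\<^bsub>H\<^esub> \<otimes>\<^bsub>H\<^esub> c g y)"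
    using assms by (simp only: ratio_cocycle) (simp add: ratio_def)
  also have "\<dots> = d (inv\<^bsub>H\<^esub> ?a \<otimes>\<^bsub>H\<^esub> ?a') \<one>\<^bsub>H\<^esub>"
    using assms by (simp only: H.left_invariant H.right_invariant H.m_closed H.inv_closed H.one_closed
        c_closed act_closed)
  also have "\<dots> = d (inv\<^bsub>H\<^esub> ?a \<otimes>\<^bsub>H\<^esub> ?a') (inv\<^bsub>H\<^esub> ?a \<otimes>\<^bsub>H\<^esub> ?a)"
    using assms by simp
  also have "\<dots> = d ?a' ?a"
    using assms by (simp only: H.left_invariant H.inv_closed c_closed act_closed)
  finally show ?thesis
    by (simp add: H.commute)
qed

section \<open>Difference sets and homoclinic pairs\<close>

lemma diff_act:
  assumes "g \<in> carrier G" "k \<in> diff (act g x) (act g y)"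
  obtains k' where "k' \<in> diff x y" "k = g \<otimes> k'"
proof
  show "inv g \<otimes> k \<in> diff x y"
    using assms by (auto simp: diff_def act_apply)
  show "k = g \<otimes> (inv g \<otimes> k)"
    using assms by (auto simp: diff_def m_assoc[symmetric])
qed

lemma diff_carrier: "k \<in> diff x y \<Longrightarrow> k \<in> carrier G"
  by (simp add: diff_def)

lemma diff_commute: "diff x y = diff y x"
  by (auto simp: diff_def)

lemma homoclinic_commute: "homoclinic x y \<longleftrightarrow> homoclinic y x"
  by (auto simp: homoclinic_def diff_commute)

lemma homoclinic_trans:
  assumes "homoclinic x y" "homoclinic y z"
  shows "homoclinic x z"
proof -
  have "diff x z \<subseteq> diff x y \<union> diff y z"
    by (auto simp: diff_def)
  then show ?thesis
    using assms finite_subset by (auto simp: homoclinic_def)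
qed

lemma homoclinic_act:
  assumes "g \<in> carrier G" "homoclinic x y"
  shows "homoclinic (act g x) (act g y)"
proof -
  have "diff (act g x) (act g y) \<subseteq> (\<lambda>k. g \<otimes> k) ` diff x y"
    by (auto elim!: diff_act[OF assms(1)])
  then show ?thesis
    using assms finite_subset by (auto simp: homoclinic_def)
qed

lemma homoclinic_radius:
  assumes "homoclinic x y"
  obtains R :: nat where "\<And>k. k \<in> diff x y \<Longrightarrow> len k \<le> R"
proof
  fix k assume "k \<in> diff x y"
  then show "len k \<le> (\<Sum>k\<in>diff x y. len k)"
    using assms by (intro member_le_sum) (auto simp: homoclinic_def)
qed

text \<open>The Hoelder condition says nothing about configurations that differ at \<open>\<one>\<close>; finiteness of
  the alphabet bounds \<open>f\<close>, so that \<open>t \<le> 0\<close> can be allowed here.\<close>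

lemma holder_exp:
  assumes "holder_continuous G S A H d f"
  obtains C \<mu> :: real where "0 < C" "0 < \<mu>"
    "\<And>x y (t::real). x \<in> X \<Longrightarrow> y \<in> X \<Longrightarrow> (\<And>k. k \<in> diff x y \<Longrightarrow> t \<le> len k) \<Longrightarrow> d (f x) (f y) \<le> C * exp (- \<mu> * t)"
proof -
  obtain C r where C: "0 < C" "0 < r" "r < 1"
    and hc: "\<And>n x y. \<lbrakk>x \<in> X; y \<in> X; \<forall>h\<in>word_ball G S n. x h = y h\<rbrakk> \<Longrightarrow> d (f x) (f y) \<le> C * r ^ n"
    using assms unfolding holder_continuous_def by metis
  have fH: "f x \<in> carrier H" if "x \<in> X" for x
    using assms that by (auto simp: holder_continuous_def)
  \<comment> \<open>Constant configurations form a finite net: the ball of radius 0 is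
    \<open>{\<one>}\<close>, so \<open>z\<close> agrees there with the constant
    \<open>z \<one>\<close>, and \<open>f z\<close> lies within \<open>C\<close> of one of finitely
    many values.\<close>
  define const where "const a = (\<lambda>h\<in>carrier G. a)" for a :: 'a
  define M where "M = 2 * C + (\<Sum>a\<in>A. \<Sum>b\<in>A. d (f (const a)) (f (const b)))"
  have bounded: "d (f x) (f y) \<le> M" if x: "x \<in> X" and y: "y \<in> X" for x y
  proof -
    have near: "d (f z) (f (const (z \<one>))) \<le> C \<and> z \<one> \<in> A \<and> const (z \<one>) \<in> X" if "z \<in> X" for z
    proof -
      have "z \<one> \<in> A" "const (z \<one>) \<in> X"
        using that by (auto simp: full_shift_def const_def)
      moreover have "z h = const (z \<one>) h" if "h \<in> word_ball G S 0" for h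
        using that by (auto simp: word_ball_def const_def len_eq_0)
      ultimately show ?thesis
        using hc[of z "const (z \<one>)" 0] that by simp
    qed
    have "d (f (const (x \<one>))) (f (const (y \<one>))) \<le> (\<Sum>b\<in>A. d (f (const (x \<one>))) (f (const b)))"
      using near[OF y] finite_A by (intro member_le_sum) auto
    also have "\<dots> \<le> (\<Sum>a\<in>A. \<Sum>b\<in>A. d (f (const a)) (f (const b)))"
      using near[OF x] finite_A
      by (intro member_le_sum[of "x \<one>" A "\<lambda>a. \<Sum>b\<in>A. d (f (const a)) (f (const b))"])
        (auto intro: sum_nonneg)
    finally have 1: "d (f (const (x \<one>))) (f (const (y \<one>))) \<le> M - 2 * C"
      by (simp add: M_def)
    have 2: "d (f x) (f y) \<le> d (f x) (f (const (x \<one>))) + d (f (const (x \<one>))) (f y)"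
      using near[OF x] near[OF y] x y fH by (intro H.triangle) auto
    have 3: "d (f (const (x \<one>))) (f y) \<le> d (f (const (x \<one>))) (f (const (y \<one>))) + d (f (const (y \<one>))) (f y)"
      using near[OF x] near[OF y] x y fH by (intro H.triangle) auto
    show ?thesis
      using 1 2 3 near[OF x] near[OF y] H.commute[of "f (const (y \<one>))" "f y"] by linarith
  qed
  define \<mu> where "\<mu> = - ln r"
  have \<mu>: "0 < \<mu>"
    using C by (simp add: \<mu>_def)
  have r: "r ^ n = exp (- \<mu> * n)" for n :: nat
    using C by (simp add: \<mu>_def exp_of_nat2_mult)
  define C' where "C' = max M (C * exp \<mu>)"
  have "0 < C'"
    using C by (simp add: C'_def less_max_iff_disj)
  moreover have "d (f x) (f y) \<le> C' * exp (- \<mu> * t)"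
    if x: "x \<in> X" and y: "y \<in> X" and far: "\<And>k. k \<in> diff x y \<Longrightarrow> t \<le> len k" for x y and t :: real
  proof (cases "t \<le> 0")
    case True
    have "d (f x) (f y) \<le> C' * 1"
      using bounded[OF x y] by (simp add: C'_def)
    also have "\<dots> \<le> C' * exp (- \<mu> * t)"
      using True \<mu> \<open>0 < C'\<close> by (intro mult_left_mono) (auto simp: mult_nonneg_nonpos)
    finally show ?thesis .
  next
    case False
    \<comment> \<open>The largest integer strictly below \<open>t\<close>, so that sites of length
      at least \<open>t\<close> lie outside the ball of radius \<open>n\<close>. Since
      \<open>t - n\<close> is at most 1, the loss is the factor \<open>exp \<mu>\<close> in
      \<open>C'\<close>.\<close>
    define n where "n = nat (\<lceil>t\<rceil> - 1)"
    have n: "real n < t" "t - 1 \<le> n"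
      using False unfolding n_def by linarith+
    have "x h = y h" if "h \<in> word_ball G S n" for h
    proof (rule ccontr)
      assume "x h \<noteq> y h"
      then have "t \<le> len h"
        using that by (intro far) (auto simp: diff_def word_ball_def)
      then show False
        using that n by (auto simp: word_ball_def)
    qed
    then have "d (f x) (f y) \<le> C * exp (- \<mu> * n)"
      using hc[OF x y, of n] unfolding r by blast
    also have "\<dots> \<le> C * exp (\<mu> - \<mu> * t)"
      using C \<mu> mult_left_mono[OF n(2), of \<mu>]
      by (intro mult_left_mono) (auto simp: algebra_simps)
    also have "\<dots> = C * exp \<mu> * exp (- \<mu> * t)"
      by (simp add: exp_diff exp_minus field_simps)
    also have "\<dots> \<le> C' * exp (- \<mu> * t)"
      by (intro mult_right_mono) (auto simp: C'_def)
    finally show ?thesis .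
  qed
  ultimately show ?thesis
    using \<mu> that by blast
qed

text \<open>The basic estimate: a further factor \<open>h\<close> on the left costs only the
  variation of \<open>c h\<close> between configurations that differ on the translate of
  \<open>diff x y\<close> by \<open>g\<close>. The constants depend on \<open>h\<close> alone, so
  the estimate can be summed along a path in the group.\<close>

lemma ratio_step:
  assumes "h \<in> carrier G"
  obtains C \<mu> :: real where "0 < C" "0 < \<mu>"
    "\<And>g x y (t::real). \<lbrakk>g \<in> carrier G; x \<in> X; y \<in> X; \<And>k. k \<in> diff x y \<Longrightarrow> t \<le> len (g \<otimes> k)\<rbrakk>
       \<Longrightarrow> d (ratio (h \<otimes> g) x y) (ratio g x y) \<le> C * exp (- \<mu> * t)"
proof -
  have "holder_continuous G S A H d (c h)"
    using assms holder by (simp add: holder_cocycle_def)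
  from holder_exp[OF this] obtain C \<mu> :: real where *: "0 < C" "0 < \<mu>"
    "\<And>x y (t::real). x \<in> X \<Longrightarrow> y \<in> X \<Longrightarrow> (\<And>k. k \<in> diff x y \<Longrightarrow> t \<le> len k)
       \<Longrightarrow> d (c h x) (c h y) \<le> C * exp (- \<mu> * t)"
    by blast
  have "d (ratio (h \<otimes> g) x y) (ratio g x y) \<le> C * exp (- \<mu> * t)"
    if "g \<in> carrier G" "x \<in> X" "y \<in> X" "\<And>k. k \<in> diff x y \<Longrightarrow> t \<le> len (g \<otimes> k)" for g x y and t :: real
    unfolding dist_ratio_mult[OF that(1) assms that(2,3)]
    using that by (intro *(3)) (auto elim: diff_act)
  with *(1,2) show ?thesis
    using that by blast
qed

section \<open>Directions with the same limits\<close>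

lemma asymp_refl: "g \<in> carrier G \<Longrightarrow> asymp g g"
  by (simp add: asymp_def homoclinic_def)

lemma asymp_trans:
  assumes "asymp g h" "asymp h k" "g \<in> carrier G" "h \<in> carrier G" "k \<in> carrier G"
  shows "asymp g k"
  unfolding asymp_def
proof (intro allI impI)
  fix x y assume xy: "homoclinic x y"
  have 1: "(\<lambda>n::nat. d (ratio (g [^] n) x y) (ratio (h [^] n) x y)
      + d (ratio (h [^] n) x y) (ratio (k [^] n) x y)) \<longlonglongrightarrow> 0 + 0"
    using assms xy by (intro tendsto_add) (auto simp: asymp_def)
  show "(\<lambda>n::nat. d (ratio (g [^] n) x y) (ratio (k [^] n) x y)) \<longlonglongrightarrow> 0"
  proof (rule Lim_null_comparison)
    show "\<forall>\<^sub>F n::nat in sequentially. norm (d (ratio (g [^] n) x y) (ratio (k [^] n) x y))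
       \<le> d (ratio (g [^] n) x y) (ratio (h [^] n) x y) + d (ratio (h [^] n) x y) (ratio (k [^] n) x y)"
      using assms xy by (intro always_eventually allI) (auto simp: homoclinic_def intro!: H.triangle)
  qed (use 1 in simp)
qed

text \<open>One leg of the walk through the quadrant: \<open>n\<close> steps by \<open>k\<close>,
  each at distance at least \<open>\<epsilon> * n\<close> from the identity, cost \<open>n\<close>
  times an exponentially small amount.\<close>

lemma asymp_mult_pow:
  fixes \<epsilon> :: real
  assumes g: "g \<in> carrier G" and k: "k \<in> carrier G" and \<epsilon>: "0 < \<epsilon>"
    and far: "\<And>(m::nat) (n::nat). \<epsilon> * real n \<le> len (k [^] m \<otimes> g [^] n)"
    and xy: "homoclinic x y"
  shows "(\<lambda>n::nat. d (ratio (k [^] n \<otimes> g [^] n) x y) (ratio (g [^] n) x y)) \<longlonglongrightarrow> 0"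
proof -
  obtain R :: nat where R: "\<And>k. k \<in> diff x y \<Longrightarrow> len k \<le> R"
    using homoclinic_radius[OF xy] by blast
  have X: "x \<in> X" "y \<in> X"
    using xy by (auto simp: homoclinic_def)
  obtain C \<mu> :: real where C: "0 < C" "0 < \<mu>"
    and step: "\<And>g x y (t::real). \<lbrakk>g \<in> carrier G; x \<in> X; y \<in> X; \<And>l. l \<in> diff x y \<Longrightarrow> t \<le> len (g \<otimes> l)\<rbrakk>
       \<Longrightarrow> d (ratio (k \<otimes> g) x y) (ratio g x y) \<le> C * exp (- \<mu> * t)"
    using ratio_step[OF k] by blast
  \<comment> \<open>Stated for every \<open>m\<close>, so that the walk is built one step at a time
    with \<open>n\<close> fixed; only afterwards is \<open>m\<close> set to
    \<open>n\<close>.\<close>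
  have bound: "d (ratio (k [^] m \<otimes> g [^] n) x y) (ratio (g [^] n) x y) \<le> m * (C * exp (- \<mu> * (\<epsilon> * real n - real R)))"
    for m n :: nat
  proof (induction m)
    case 0
    then show ?case using X g by simp
  next
    case (Suc m)
    have cl: "k [^] m \<otimes> g [^] n \<in> carrier G"
      using g k by simp
    have eq: "k [^] Suc m \<otimes> g [^] n = k \<otimes> (k [^] m \<otimes> g [^] n)"
      using g k by (metis nat_pow_Suc2 m_assoc nat_pow_closed)
    have "d (ratio (k [^] Suc m \<otimes> g [^] n) x y) (ratio (k [^] m \<otimes> g [^] n) x y)
        \<le> C * exp (- \<mu> * (\<epsilon> * real n - real R))"
      unfolding eq
    proof (intro step cl X)
      fix l assume l: "l \<in> diff x y"
      then have "l \<in> carrier G" by (simp add: diff_def)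
      then show "\<epsilon> * real n - real R \<le> len (k [^] m \<otimes> g [^] n \<otimes> l)"
        using len_translate_ge[OF cl, of l] far[of n m] R[OF l] by linarith
    qed
    moreover have "d (ratio (k [^] Suc m \<otimes> g [^] n) x y) (ratio (g [^] n) x y)
      \<le> d (ratio (k [^] Suc m \<otimes> g [^] n) x y) (ratio (k [^] m \<otimes> g [^] n) x y)
        + d (ratio (k [^] m \<otimes> g [^] n) x y) (ratio (g [^] n) x y)"
      using g k X by (intro H.triangle) auto
    ultimately show ?case
      using Suc by (simp add: algebra_simps)
  qed
  have "(\<lambda>n. C * exp (\<mu> * R) * (real n * exp (- \<mu> * \<epsilon>) ^ n)) \<longlonglongrightarrow> C * exp (\<mu> * R) * 0"
    using C \<epsilon> by (intro tendsto_mult_left powser_times_n_limit_0) simp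
  moreover have "(\<lambda>n. C * exp (\<mu> * R) * (real n * exp (- \<mu> * \<epsilon>) ^ n))
      = (\<lambda>n. n * (C * exp (- \<mu> * (\<epsilon> * real n - real R))))"
    by (simp add: exp_of_nat_mult[symmetric] algebra_simps exp_add[symmetric])
  ultimately have "(\<lambda>n. n * (C * exp (- \<mu> * (\<epsilon> * real n - real R)))) \<longlonglongrightarrow> 0"
    by simp
  then show ?thesis
    by (rule Lim_null_comparison[rotated]) (intro always_eventually allI, use bound in simp)
qed

lemma asymp_commuting:
  fixes \<epsilon> :: real
  assumes g: "g \<in> carrier G" and k: "k \<in> carrier G" and comm: "g \<otimes> k = k \<otimes> g" and \<epsilon>: "0 < \<epsilon>"
    and far: "\<And>(m::nat) (n::nat). \<epsilon> * real n \<le> len (k [^] m \<otimes> g [^] n)" "\<And>(m::nat) (n::nat). \<epsilon> * real m \<le> len (k [^] m \<otimes> g [^] n)"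
  shows "asymp g k"
  unfolding asymp_def
proof (intro allI impI)
  fix x y assume xy: "homoclinic x y"
  then have X: "x \<in> X" "y \<in> X" by (auto simp: homoclinic_def)
  have comm': "g [^] m \<otimes> k [^] n = k [^] n \<otimes> g [^] m" for m n :: nat
    using g k comm by (metis group_commutes_pow nat_pow_closed)
  have 1: "(\<lambda>n::nat. d (ratio (k [^] n \<otimes> g [^] n) x y) (ratio (g [^] n) x y)) \<longlonglongrightarrow> 0"
    by (rule asymp_mult_pow[OF g k \<epsilon> far(1) xy])
  have 2: "(\<lambda>n::nat. d (ratio (g [^] n \<otimes> k [^] n) x y) (ratio (k [^] n) x y)) \<longlonglongrightarrow> 0"
    by (rule asymp_mult_pow[OF k g \<epsilon> _ xy]) (simp add: comm' far(2))
  show "(\<lambda>n::nat. d (ratio (g [^] n) x y) (ratio (k [^] n) x y)) \<longlonglongrightarrow> 0"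
  proof (rule Lim_null_comparison)
    show "\<forall>\<^sub>F n::nat in sequentially. norm (d (ratio (g [^] n) x y) (ratio (k [^] n) x y))
       \<le> d (ratio (k [^] n \<otimes> g [^] n) x y) (ratio (g [^] n) x y)
        + d (ratio (g [^] n \<otimes> k [^] n) x y) (ratio (k [^] n) x y)"
    proof (intro always_eventually allI)
      fix n :: nat
      have "d (ratio (g [^] n) x y) (ratio (k [^] n) x y)
        \<le> d (ratio (g [^] n) x y) (ratio (k [^] n \<otimes> g [^] n) x y)
          + d (ratio (k [^] n \<otimes> g [^] n) x y) (ratio (k [^] n) x y)"
        using g k X by (intro H.triangle) auto
      then show "norm (d (ratio (g [^] n) x y) (ratio (k [^] n) x y))
       \<le> d (ratio (k [^] n \<otimes> g [^] n) x y) (ratio (g [^] n) x y)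
        + d (ratio (g [^] n \<otimes> k [^] n) x y) (ratio (k [^] n) x y)"
        by (simp add: comm' H.commute)
    qed
    show "(\<lambda>n::nat. d (ratio (k [^] n \<otimes> g [^] n) x y) (ratio (g [^] n) x y)
        + d (ratio (g [^] n \<otimes> k [^] n) x y) (ratio (k [^] n) x y)) \<longlonglongrightarrow> 0"
      using tendsto_add[OF 1 2] by simp
  qed
qed

section \<open>Limits along a direction and uniform bounds for them\<close>

lemma ratio_power_conv:
  assumes g: "direction g" and xy: "homoclinic x y"
  shows "\<exists>l. H.conv (\<lambda>n::nat. ratio (g [^] n) x y) l"
proof -
  obtain \<epsilon> where gG: "g \<in> carrier G" and \<epsilon>: "\<epsilon> > 0" "\<And>n::nat. \<epsilon> * real n \<le> len (g [^] n)"
    using g by (auto simp: direction_def)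
  obtain R :: nat where R: "\<And>k. k \<in> diff x y \<Longrightarrow> len k \<le> R"
    using homoclinic_radius[OF xy] by blast
  have X: "x \<in> X" "y \<in> X"
    using xy by (auto simp: homoclinic_def)
  obtain C \<mu> :: real where C: "0 < C" "0 < \<mu>"
    and step: "\<And>h x y (t::real). \<lbrakk>h \<in> carrier G; x \<in> X; y \<in> X; \<And>l. l \<in> diff x y \<Longrightarrow> t \<le> len (h \<otimes> l)\<rbrakk>
       \<Longrightarrow> d (ratio (g \<otimes> h) x y) (ratio h x y) \<le> C * exp (- \<mu> * t)"
    using ratio_step[OF gG] by blast
  show ?thesis
  proof (rule H.geometric_conv)
    show "range (\<lambda>n::nat. ratio (g [^] n) x y) \<subseteq> carrier H"
      using gG X by auto
    show "0 < \<mu> * \<epsilon>"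
      using C \<epsilon> by simp
    fix n :: nat
    \<comment> \<open>The radius \<open>R\<close> of the difference set enters the constant as
      \<open>exp (\<mu> * R)\<close>. This is enough for convergence but useless for continuity of
      the limit.\<close>
    have "d (ratio (g \<otimes> g [^] n) x y) (ratio (g [^] n) x y) \<le> C * exp (- \<mu> * (\<epsilon> * real n - real R))"
    proof (intro step X)
      fix l assume l: "l \<in> diff x y"
      show "\<epsilon> * real n - real R \<le> len (g [^] n \<otimes> l)"
        using len_translate_ge[of "g [^] n" l] \<epsilon>(2)[of n] R[OF l] gG diff_carrier[OF l] by simp
    qed (use gG in simp)
    also have "\<dots> = C * exp (\<mu> * R) * exp (- (\<mu> * \<epsilon>) * n)"
      by (simp add: algebra_simps exp_add[symmetric])
    finally show "d (ratio (g [^] Suc n) x y) (ratio (g [^] n) x y) \<le> C * exp (\<mu> * R) * exp (- (\<mu> * \<epsilon>) * n)"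
      using gG by (simp only: nat_pow_Suc2)
  qed
qed

definition tau :: "'g \<Rightarrow> ('g \<Rightarrow> 'a) \<Rightarrow> ('g \<Rightarrow> 'a) \<Rightarrow> 'h" where
  "tau g x y = (SOME l. H.conv (\<lambda>n::nat. ratio (g [^] n) x y) l)"

lemma tau_conv:
  assumes "direction g" "homoclinic x y"
  shows "H.conv (\<lambda>n::nat. ratio (g [^] n) x y) (tau g x y)"
  unfolding tau_def by (rule someI_ex[OF ratio_power_conv[OF assms]])

lemma tau_asymp_conv:
  assumes "direction g" "homoclinic x y" "asymp g k" "k \<in> carrier G"
  shows "H.conv (\<lambda>n::nat. ratio (k [^] n) x y) (tau g x y)"
  by (rule H.conv_asymp[OF tau_conv[OF assms(1,2)]]) (use assms in \<open>auto simp: asymp_def homoclinic_def\<close>)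

lemma tau_closed [simp]: "direction g \<Longrightarrow> homoclinic x y \<Longrightarrow> tau g x y \<in> carrier H"
  using H.conv_carrier(2) tau_conv by blast

lemma tau_mult:
  assumes g: "direction g" and xy: "homoclinic x y" and yz: "homoclinic y z"
  shows "tau g x z = tau g x y \<otimes>\<^bsub>H\<^esub> tau g y z"
proof (rule H.conv_unique)
  have "g \<in> carrier G"
    using g by (simp add: direction_def)
  then have "ratio (g [^] n) x y \<otimes>\<^bsub>H\<^esub> ratio (g [^] n) y z = ratio (g [^] n) x z" for n :: nat
    using xy yz by (intro ratio_mult) (auto simp: homoclinic_def)
  then show "H.conv (\<lambda>n::nat. ratio (g [^] n) x z) (tau g x y \<otimes>\<^bsub>H\<^esub> tau g y z)"
    using H.conv_mult[OF tau_conv[OF g xy] tau_conv[OF g yz]] by simp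
  show "H.conv (\<lambda>n::nat. ratio (g [^] n) x z) (tau g x z)"
    by (rule tau_conv[OF g homoclinic_trans[OF xy yz]])
qed

text \<open>Here the constants are independent of the radius and of the number of differing sites.
  The assumption that \<open>g [^] j \<otimes> k\<close> recedes linearly controls large
  \<open>j\<close>, the assumption that \<open>k\<close> starts at distance \<open>t\<close>
  controls small \<open>j\<close>, and the steps sum to a geometric series.\<close>

lemma ratio_power_bound:
  fixes \<epsilon> :: real
  assumes g: "g \<in> carrier G" and \<epsilon>: "0 < \<epsilon>"
  obtains K \<nu> :: real where "0 < K" "0 < \<nu>"
    "\<And>x y (t::real) n::nat. \<lbrakk>x \<in> X; y \<in> X; \<And>k. k \<in> diff x y \<Longrightarrow> t \<le> len k;
        \<And>k (j::nat). k \<in> diff x y \<Longrightarrow> \<epsilon> * real j \<le> len (g [^] j \<otimes> k)\<rbrakk>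
       \<Longrightarrow> d (ratio (g [^] n) x y) \<one>\<^bsub>H\<^esub> \<le> K * exp (- \<nu> * t)"
proof -
  obtain C \<mu> :: real where C: "0 < C" "0 < \<mu>"
    and step: "\<And>h x y (t::real). \<lbrakk>h \<in> carrier G; x \<in> X; y \<in> X; \<And>l. l \<in> diff x y \<Longrightarrow> t \<le> len (h \<otimes> l)\<rbrakk>
       \<Longrightarrow> d (ratio (g \<otimes> h) x y) (ratio h x y) \<le> C * exp (- \<mu> * t)"
    using ratio_step[OF g] by blast
  define L where "L = real (len g)"
  \<comment> \<open>\<open>\<alpha>\<close> is the weight in a convex combination of the two lower
    bounds \<open>t - L * j\<close> and \<open>\<epsilon> * j\<close> for
    \<open>len (g [^] j \<otimes> k)\<close>. Choosing
    \<open>\<alpha> * (\<epsilon> + L) = \<epsilon> / 2\<close> retains half of the growth in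
    \<open>j\<close> together with the positive multiple \<open>\<alpha> * t\<close>.\<close>
  define \<alpha> where "\<alpha> = \<epsilon> / (2 * (\<epsilon> + L))"
  have L: "0 \<le> L" by (simp add: L_def)
  have \<alpha>: "0 < \<alpha>" "\<alpha> \<le> 1" "\<alpha> * (\<epsilon> + L) = \<epsilon> / 2"
    using \<epsilon> L by (simp_all add: \<alpha>_def field_simps)
  define r where "r = exp (- \<mu> * (\<epsilon> / 2))"
  have r: "0 < r" "r < 1"
    using C \<epsilon> by (simp_all add: r_def)
  have bound: "d (ratio (g [^] n) x y) \<one>\<^bsub>H\<^esub> \<le> C / (1 - r) * exp (- (\<mu> * \<alpha>) * t)"
    if X: "x \<in> X" "y \<in> X" and far: "\<And>k. k \<in> diff x y \<Longrightarrow> t \<le> len k"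
      and away: "\<And>k (j::nat). k \<in> diff x y \<Longrightarrow> \<epsilon> * real j \<le> len (g [^] j \<otimes> k)"
    for x y and t :: real and n :: nat
  proof -
    have one_step: "d (ratio (g [^] Suc j) x y) (ratio (g [^] j) x y) \<le> C * exp (- (\<mu> * \<alpha>) * t) * r ^ j"
      for j :: nat
    proof -
      have "d (ratio (g \<otimes> g [^] j) x y) (ratio (g [^] j) x y) \<le> C * exp (- \<mu> * (\<alpha> * t + \<epsilon> / 2 * j))"
      proof (intro step X)
        fix k assume k: "k \<in> diff x y"
        have "t - L * j \<le> len (g [^] j \<otimes> k)"
        proof -
          have "len k \<le> len (g [^] j) + len (g [^] j \<otimes> k)"
            using g diff_carrier[OF k] by (intro len_le_translate) auto
          also have "\<dots> \<le> j * len g + len (g [^] j \<otimes> k)"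
            using len_pow_le[OF g, of j] by simp
          finally have "real (len k) \<le> real (j * len g + len (g [^] j \<otimes> k))"
            by (simp only: of_nat_le_iff)
          then show ?thesis
            using far[OF k] by (simp add: L_def algebra_simps)
        qed
        then have "\<alpha> * (t - L * j) + (1 - \<alpha>) * (\<epsilon> * j) \<le> \<alpha> * len (g [^] j \<otimes> k) + (1 - \<alpha>) * len (g [^] j \<otimes> k)"
          using away[OF k, of j] \<alpha> by (intro add_mono mult_left_mono) auto
        moreover have "\<alpha> * (t - L * j) + (1 - \<alpha>) * (\<epsilon> * j) = \<alpha> * t + (\<epsilon> - \<alpha> * (\<epsilon> + L)) * j"
          by (simp add: algebra_simps)
        ultimately show "\<alpha> * t + \<epsilon> / 2 * j \<le> len (g [^] j \<otimes> k)"
          unfolding \<alpha>(3) by (simp add: algebra_simps)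
      qed (use g in simp)
      moreover have "C * exp (- \<mu> * (\<alpha> * t + \<epsilon> / 2 * j)) = C * exp (- (\<mu> * \<alpha>) * t) * r ^ j"
        by (simp add: r_def exp_of_nat_mult[symmetric] exp_add[symmetric] algebra_simps)
      ultimately show ?thesis
        using g by (simp only: nat_pow_Suc2)
    qed
    define B where "B = C * exp (- (\<mu> * \<alpha>) * t)"
    have "d (ratio (g [^] n) x y) \<one>\<^bsub>H\<^esub> \<le> B * (\<Sum>j<n. r ^ j)"
    proof (induction n)
      case 0
      then show ?case using X by (simp add: ratio_one)
    next
      case (Suc n)
      have "d (ratio (g [^] Suc n) x y) \<one>\<^bsub>H\<^esub>
        \<le> d (ratio (g [^] Suc n) x y) (ratio (g [^] n) x y) + d (ratio (g [^] n) x y) \<one>\<^bsub>H\<^esub>"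
        using g X by (intro H.triangle) auto
      also have "\<dots> \<le> B * r ^ n + B * (\<Sum>j<n. r ^ j)"
        using Suc one_step[of n] unfolding B_def by (intro add_mono)
      finally show ?case
        by (simp add: algebra_simps)
    qed
    also have "\<dots> \<le> B * (1 / (1 - r))"
    proof (intro mult_left_mono)
      show "(\<Sum>j<n. r ^ j) \<le> 1 / (1 - r)"
        using r by (simp add: sum_gp_strict divide_right_mono)
    qed (use C in \<open>simp add: B_def\<close>)
    finally show ?thesis
      by (simp add: B_def field_simps)
  qed
  show ?thesis
  proof (rule that[of "C / (1 - r)" "\<mu> * \<alpha>"])
    show "0 < C / (1 - r)" "0 < \<mu> * \<alpha>"
      using C r \<alpha> by simp_all
  qed (rule bound)
qed

text \<open>A site \<open>k\<close> cannot lie near both rays \<open>(g\<^sup>n)\<close> and \<open>(g\<^sup>-\<^sup>n)\<close>. Changing first the sites away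
  from one ray and then those away from the other bounds \<open>tau\<close> independently of the number of
  sites changed.\<close>

lemma tau_bound:
  assumes g: "direction g" and inv: "asymp g (inv g)"
  obtains K \<nu> :: real where "0 < K" "0 < \<nu>"
    "\<And>x y (t::real). \<lbrakk>homoclinic x y; 0 \<le> t; \<And>k. k \<in> diff x y \<Longrightarrow> t \<le> len k\<rbrakk>
       \<Longrightarrow> d (tau g x y) \<one>\<^bsub>H\<^esub> \<le> K * exp (- \<nu> * t)"
proof -
  obtain \<epsilon> where gG: "g \<in> carrier G" and \<epsilon>: "\<epsilon> > 0" "\<And>n::nat. \<epsilon> * real n \<le> len (g [^] n)"
    using g by (auto simp: direction_def)
  have igG: "inv g \<in> carrier G"
    using gG by simp
  obtain K \<nu> :: real where K: "0 < K" "0 < \<nu>" and plus: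
    "\<And>x y (t::real) n::nat. \<lbrakk>x \<in> X; y \<in> X; \<And>k. k \<in> diff x y \<Longrightarrow> t \<le> len k;
        \<And>k (j::nat). k \<in> diff x y \<Longrightarrow> \<epsilon> * real j \<le> len (g [^] j \<otimes> k)\<rbrakk>
       \<Longrightarrow> d (ratio (g [^] n) x y) \<one>\<^bsub>H\<^esub> \<le> K * exp (- \<nu> * t)"
    using ratio_power_bound[OF gG \<epsilon>(1)] by blast
  obtain K' \<nu>' :: real where K': "0 < K'" "0 < \<nu>'" and minus:
    "\<And>x y (t::real) n::nat. \<lbrakk>x \<in> X; y \<in> X; \<And>k. k \<in> diff x y \<Longrightarrow> t \<le> len k;
        \<And>k (j::nat). k \<in> diff x y \<Longrightarrow> \<epsilon> * real j \<le> len (inv g [^] j \<otimes> k)\<rbrakk>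
       \<Longrightarrow> d (ratio (inv g [^] n) x y) \<one>\<^bsub>H\<^esub> \<le> K' * exp (- \<nu>' * t)"
    using ratio_power_bound[OF igG \<epsilon>(1)] by blast
  \<comment> \<open>In the left-invariant word metric \<open>len (g [^] j \<otimes> k)\<close> is
    the distance from \<open>k\<close> to \<open>inv g [^] j\<close>, so \<open>P k\<close> says
    that \<open>k\<close> keeps away from the backward ray.\<close>
  define P where "P k \<longleftrightarrow> (\<forall>j::nat. \<epsilon> * real j \<le> len (g [^] j \<otimes> k))" for k
  \<comment> \<open>A site \<open>k\<close> too close both to \<open>inv g [^] j\<close> and to
    \<open>g [^] i\<close> would join them by a path shorter than
    \<open>\<epsilon> * (j + i)\<close>, against linear growth. The same \<open>\<epsilon>\<close>
    serves both rays.\<close>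
  have notP: "\<epsilon> * real i \<le> len (inv g [^] i \<otimes> k)" if k: "k \<in> carrier G" "\<not> P k" for k and i :: nat
  proof (rule ccontr)
    assume i: "\<not> \<epsilon> * real i \<le> len (inv g [^] i \<otimes> k)"
    obtain j :: nat where j: "\<not> \<epsilon> * real j \<le> len (g [^] j \<otimes> k)"
      using k(2) by (auto simp: P_def)
    have "g [^] (j + i) = (g [^] j \<otimes> k) \<otimes> inv (inv g [^] i \<otimes> k)"
      using gG k(1) by (simp add: nat_pow_mult[symmetric] inv_mult_group nat_pow_inv m_assoc)
        (simp add: m_assoc[symmetric])
    then have "len (g [^] (j + i)) \<le> len (g [^] j \<otimes> k) + len (inv g [^] i \<otimes> k)"
      using len_mult_le[of "g [^] j \<otimes> k" "inv (inv g [^] i \<otimes> k)"] gG k(1) by (simp add: len_inv)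
    then show False
      using i j \<epsilon>(2)[of "j + i"] by (simp add: algebra_simps)
  qed
  have lim_le: "d l \<one>\<^bsub>H\<^esub> \<le> B" if "H.conv u l" "\<And>n. d (u n) \<one>\<^bsub>H\<^esub> \<le> B" for u l B
    using H.conv_dist[OF that(1) H.conv_const[of "\<one>\<^bsub>H\<^esub>"]] that(2)
    by (intro LIMSEQ_le_const2) auto
  have bound: "d (tau g x y) \<one>\<^bsub>H\<^esub> \<le> (K + K') * exp (- min \<nu> \<nu>' * t)"
    if xy: "homoclinic x y" and t: "0 \<le> t" and far: "\<And>k. k \<in> diff x y \<Longrightarrow> t \<le> len k" for x y and t :: real
  proof -
    \<comment> \<open>Passing from \<open>x\<close> to \<open>w\<close> changes only sites with
      \<open>P\<close>, passing from \<open>w\<close> to \<open>y\<close> only the others; each half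
      is handled along its own ray.\<close>
    define w where "w = (\<lambda>k\<in>carrier G. if P k then y k else x k)"
    have X: "x \<in> X" "y \<in> X"
      using xy by (auto simp: homoclinic_def)
    have wX: "w \<in> X"
      using X by (auto simp: w_def full_shift_def)
    have xw: "k \<in> diff x y \<and> P k" if "k \<in> diff x w" for k
      using that by (auto simp: diff_def w_def split: if_splits)
    have wy: "k \<in> diff x y \<and> \<not> P k" if "k \<in> diff w y" for k
      using that by (auto simp: diff_def w_def split: if_splits)
    have fin: "homoclinic x w" "homoclinic w y"
      using xy wX xw wy finite_subset[of "diff x w" "diff x y"] finite_subset[of "diff w y" "diff x y"]
      by (auto simp: homoclinic_def)
    have 1: "d (tau g x w) \<one>\<^bsub>H\<^esub> \<le> K * exp (- \<nu> * t)"
    proof (rule lim_le[OF tau_conv[OF g fin(1)]])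
      fix n :: nat
      show "d (ratio (g [^] n) x w) \<one>\<^bsub>H\<^esub> \<le> K * exp (- \<nu> * t)"
        using X wX xw far by (intro plus) (auto simp: P_def)
    qed
    \<comment> \<open>The sites near the backward ray recede under the inverse of \<open>g\<close>;
      since \<open>g\<close> and its inverse have the same limits, \<open>tau g\<close> may be
      evaluated there.\<close>
    have 2: "d (tau g w y) \<one>\<^bsub>H\<^esub> \<le> K' * exp (- \<nu>' * t)"
    proof (rule lim_le[OF tau_asymp_conv[OF g fin(2) inv igG]])
      fix n :: nat
      show "d (ratio (inv g [^] n) w y) \<one>\<^bsub>H\<^esub> \<le> K' * exp (- \<nu>' * t)"
        using X wX wy far by (intro minus notP) (auto simp: diff_carrier)
    qed
    have "d (tau g x y) \<one>\<^bsub>H\<^esub> = d (tau g x w \<otimes>\<^bsub>H\<^esub> tau g w y) (\<one>\<^bsub>H\<^esub> \<otimes>\<^bsub>H\<^esub> \<one>\<^bsub>H\<^esub>)"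
      using tau_mult[OF g fin] by simp
    also have "\<dots> \<le> d (tau g x w) \<one>\<^bsub>H\<^esub> + d (tau g w y) \<one>\<^bsub>H\<^esub>"
      using g fin by (intro H.dist_mult_le) auto
    also have "\<dots> \<le> K * exp (- min \<nu> \<nu>' * t) + K' * exp (- min \<nu> \<nu>' * t)"
    proof (intro add_mono)
      have "K * exp (- \<nu> * t) \<le> K * exp (- min \<nu> \<nu>' * t)" "K' * exp (- \<nu>' * t) \<le> K' * exp (- min \<nu> \<nu>' * t)"
        using K K' t by (auto intro!: mult_left_mono mult_right_mono)
      with 1 2 show "d (tau g x w) \<one>\<^bsub>H\<^esub> \<le> K * exp (- min \<nu> \<nu>' * t)"
        "d (tau g w y) \<one>\<^bsub>H\<^esub> \<le> K' * exp (- min \<nu> \<nu>' * t)"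
        by linarith+
    qed
    finally show ?thesis
      by (simp add: algebra_simps)
  qed
  show ?thesis
  proof (rule that[of "K + K'" "min \<nu> \<nu>'"])
    show "0 < K + K'" "0 < min \<nu> \<nu>'"
      using K K' by auto
  qed (rule bound)
qed

section \<open>Equivariance and the transfer function\<close>

text \<open>The ratio at \<open>g [^] n \<otimes> v\<close> has two limits. By the cocycle identity
  it is a ratio at \<open>g [^] n\<close> for the translated pair, multiplied by values of
  \<open>c v\<close>. By \<open>pow_conjugate\<close> it is also a ratio at \<open>v\<close> times a
  power of the conjugate of \<open>g\<close>, and there the left factor \<open>v\<close> is
  asymptotically negligible. Both elements being asymptotic to \<open>g0\<close>, comparison gives
  the formula.\<close>

lemma tau_equivariant:
  assumes g0: "direction g0" and g: "g \<in> carrier G" "asymp g0 g" and v: "v \<in> carrier G"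
    and g': "direction (inv v \<otimes> g \<otimes> v)" "asymp g0 (inv v \<otimes> g \<otimes> v)"
    and xy: "homoclinic x y"
  shows "tau g0 x y = inv\<^bsub>H\<^esub> c v x \<otimes>\<^bsub>H\<^esub> tau g0 (act v x) (act v y) \<otimes>\<^bsub>H\<^esub> c v y"
proof (rule H.conv_unique)
  let ?g' = "inv v \<otimes> g \<otimes> v"
  obtain \<epsilon> where \<epsilon>: "\<epsilon> > 0" "\<And>n::nat. \<epsilon> * real n \<le> len (?g' [^] n)" and g'G: "?g' \<in> carrier G"
    using g'(1) by (auto simp: direction_def)
  obtain R :: nat where R: "\<And>k. k \<in> diff x y \<Longrightarrow> len k \<le> R"
    using homoclinic_radius[OF xy] by blast
  have X: "x \<in> X" "y \<in> X"
    using xy by (auto simp: homoclinic_def)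
  obtain C \<mu> :: real where C: "0 < C" "0 < \<mu>"
    and step: "\<And>h x y (t::real). \<lbrakk>h \<in> carrier G; x \<in> X; y \<in> X; \<And>l. l \<in> diff x y \<Longrightarrow> t \<le> len (h \<otimes> l)\<rbrakk>
       \<Longrightarrow> d (ratio (v \<otimes> h) x y) (ratio h x y) \<le> C * exp (- \<mu> * t)"
    using ratio_step[OF v] by blast
  show "H.conv (\<lambda>n::nat. ratio (g [^] n \<otimes> v) x y) (tau g0 x y)"
  proof (rule H.conv_asymp[OF tau_asymp_conv[OF g0 xy g'(2) g'G]])
    show "range (\<lambda>n::nat. ratio (g [^] n \<otimes> v) x y) \<subseteq> carrier H"
      using g v X by auto
    have bound: "d (ratio (v \<otimes> ?g' [^] n) x y) (ratio (?g' [^] n) x y)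
        \<le> C * exp (- \<mu> * (\<epsilon> * real n - real R))" for n :: nat
    proof (intro step X)
      fix l assume l: "l \<in> diff x y"
      show "\<epsilon> * real n - real R \<le> len (?g' [^] n \<otimes> l)"
        using len_translate_ge[of "?g' [^] n" l] \<epsilon>(2)[of n] R[OF l] g'G diff_carrier[OF l] by simp
    qed (use g'G in simp)
    have eq: "C * exp (- \<mu> * (\<epsilon> * real n - real R)) = C * exp (\<mu> * R) * exp (- \<mu> * \<epsilon>) ^ n" for n :: nat
      by (simp add: exp_of_nat_mult[symmetric] algebra_simps exp_add[symmetric])
    have bound': "norm (d (ratio (?g' [^] n) x y) (ratio (v \<otimes> ?g' [^] n) x y))
        \<le> C * exp (\<mu> * R) * exp (- \<mu> * \<epsilon>) ^ n" for n :: nat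
      using bound[of n] unfolding eq by (simp add: H.commute)
    have "(\<lambda>n. C * exp (\<mu> * R) * exp (- \<mu> * \<epsilon>) ^ n) \<longlonglongrightarrow> C * exp (\<mu> * R) * 0"
      using C \<epsilon> by (intro tendsto_mult_left LIMSEQ_realpow_zero) auto
    then have "(\<lambda>n. C * exp (\<mu> * R) * exp (- \<mu> * \<epsilon>) ^ n) \<longlonglongrightarrow> 0"
      by simp
    then show "(\<lambda>n::nat. d (ratio (?g' [^] n) x y) (ratio (g [^] n \<otimes> v) x y)) \<longlonglongrightarrow> 0"
      unfolding pow_conjugate[OF g(1) v]
      by (rule Lim_null_comparison[rotated])
        (intro always_eventually allI bound')
  qed
  have "H.conv (\<lambda>n::nat. ratio (g [^] n) (act v x) (act v y)) (tau g0 (act v x) (act v y))"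
    by (rule tau_asymp_conv[OF g0 homoclinic_act[OF v xy] g(2,1)])
  then have "H.conv (\<lambda>n::nat. inv\<^bsub>H\<^esub> c v x \<otimes>\<^bsub>H\<^esub> ratio (g [^] n) (act v x) (act v y) \<otimes>\<^bsub>H\<^esub> c v y)
     (inv\<^bsub>H\<^esub> c v x \<otimes>\<^bsub>H\<^esub> tau g0 (act v x) (act v y) \<otimes>\<^bsub>H\<^esub> c v y)"
    using v X by (intro H.conv_mult H.conv_const) auto
  then show "H.conv (\<lambda>n::nat. ratio (g [^] n \<otimes> v) x y)
     (inv\<^bsub>H\<^esub> c v x \<otimes>\<^bsub>H\<^esub> tau g0 (act v x) (act v y) \<otimes>\<^bsub>H\<^esub> c v y)"
    using g(1) v X by (simp add: ratio_cocycle)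
qed

text \<open>Equivariance of \<open>tau g0\<close> is required only under a generating set
  \<open>V\<close>, with a direction \<open>g\<close> that may depend on \<open>v\<close>: the
  resulting identity for \<open>c\<close> propagates from generators to words.\<close>

theorem cohomologous_to_hom:
  assumes g0: "direction g0" and inv: "asymp g0 (inv g0)"
    and V: "V \<subseteq> carrier G" "\<And>h. h \<in> carrier G \<Longrightarrow> \<exists>w. set w \<subseteq> V \<and> foldr (\<otimes>) w \<one> = h"
    and dirs: "\<And>v. v \<in> V \<Longrightarrow> \<exists>g\<in>carrier G. asymp g0 g \<and> direction (inv v \<otimes> g \<otimes> v)
                  \<and> asymp g0 (inv v \<otimes> g \<otimes> v)"
  shows "\<exists>\<phi>\<in>hom G H. holder_cohomologous G S A H d c (\<lambda>g x. \<phi> g)"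
proof (cases "A = {}")
  \<comment> \<open>An empty alphabet offers no constant configuration as base point, but then the
    shift is empty and every condition on it is vacuous.\<close>
  case True
  then have "X = {}"
    using one_closed unfolding full_shift_def by blast
  then have "holder_cohomologous G S A H d c (\<lambda>g x. \<one>\<^bsub>H\<^esub>)"
    by (auto simp: holder_cohomologous_def holder_continuous_def intro!: exI[of _ "1::real"] exI[of _ "1/2::real"])
  moreover have "(\<lambda>_. \<one>\<^bsub>H\<^esub>) \<in> hom G H"
    by (simp add: hom_def)
  ultimately show ?thesis
    by (intro bexI[of _ "\<lambda>_. \<one>\<^bsub>H\<^esub>"])
next
  case False
  then obtain a where a: "a \<in> A" by blast
  define x0 where "x0 = (\<lambda>k\<in>carrier G. a)"
  have x0: "x0 \<in> X"
    using a by (auto simp: x0_def full_shift_def)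
  have act_x0: "act g x0 = x0" if "g \<in> carrier G" for g
    using that by (auto simp: x0_def shift_act_def restrict_def)
  \<comment> \<open>Homoclinic approximations of \<open>y\<close>: outside the ball they take the
    value \<open>a\<close> of \<open>x0\<close>, so that \<open>tau g0 x0\<close> is available for
    them.\<close>
  define trunc where "trunc n y = (\<lambda>k\<in>carrier G. if len k \<le> n then y k else a)" for n and y :: "'g \<Rightarrow> 'a"
  have trunc_X: "trunc n y \<in> X" if "y \<in> X" for n y
    using that a by (auto simp: trunc_def full_shift_def)
  have trunc_hom: "homoclinic x0 (trunc n y)" if "y \<in> X" for n y
  proof -
    have "diff x0 (trunc n y) \<subseteq> word_ball G S n"
      by (auto simp: diff_def x0_def trunc_def word_ball_def)
    then show ?thesis
      using that x0 trunc_X finite_subset[OF _ finite_word_ball] by (simp add: homoclinic_def)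
  qed
  obtain K \<nu> :: real where K: "0 < K" "0 < \<nu>" and tau_1:
    "\<And>x y (t::real). \<lbrakk>homoclinic x y; 0 \<le> t; \<And>k. k \<in> diff x y \<Longrightarrow> t \<le> len k\<rbrakk>
       \<Longrightarrow> d (tau g0 x y) \<one>\<^bsub>H\<^esub> \<le> K * exp (- \<nu> * t)"
    using tau_bound[OF g0 inv] by blast
  have tau_dist: "d (tau g0 x0 y) (tau g0 x0 z) \<le> K * exp (- \<nu> * t)"
    if y: "homoclinic x0 y" and z: "homoclinic x0 z" and t: "0 \<le> t" "\<And>k. k \<in> diff y z \<Longrightarrow> t \<le> len k"
    for y z and t :: real
  proof -
    have yz: "homoclinic y z"
      using y z homoclinic_commute homoclinic_trans by blast
    have "d (tau g0 x0 z) (tau g0 x0 y)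
        = d (tau g0 x0 y \<otimes>\<^bsub>H\<^esub> tau g0 y z) (tau g0 x0 y \<otimes>\<^bsub>H\<^esub> \<one>\<^bsub>H\<^esub>)"
      using tau_mult[OF g0 y yz] g0 y by simp
    also have "\<dots> = d (tau g0 y z) \<one>\<^bsub>H\<^esub>"
      using g0 y yz by (intro H.left_invariant) auto
    also have "\<dots> \<le> K * exp (- \<nu> * t)"
      using yz t by (rule tau_1)
    finally show ?thesis
      by (simp add: H.commute)
  qed
  define u where "u y n = tau g0 x0 (trunc n y)" for y n
  have "\<exists>l. H.conv (u y) l" if y: "y \<in> X" for y
  proof (rule H.geometric_conv)
    show "range (u y) \<subseteq> carrier H"
      using trunc_hom[OF y] g0 by (auto simp: u_def)
    fix n
    show "d (u y (Suc n)) (u y n) \<le> K * exp (- \<nu> * n)"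
      unfolding u_def using trunc_hom[OF y]
      by (intro tau_dist) (auto simp: diff_def trunc_def split: if_splits)
  qed (rule K)
  then obtain b where b: "\<And>y. y \<in> X \<Longrightarrow> H.conv (u y) (b y)"
    by metis
  have bH: "b y \<in> carrier H" if "y \<in> X" for y
    using H.conv_carrier(2)[OF b[OF that]] .
  have b_holder: "holder_continuous G S A H d b"
    unfolding holder_continuous_def
  proof (rule conjI, use bH in blast, rule exI[of _ K], rule exI[of _ "exp (- \<nu>)"],
      intro conjI allI ballI impI)
    fix n y z assume y: "y \<in> X" and z: "z \<in> X" and eq: "\<forall>h\<in>word_ball G S n. y h = z h"
    have far: "n \<le> len k" if "k \<in> diff y z" for k
      using that eq by (force simp: diff_def word_ball_def)
    have "d (u y m) (u z m) \<le> K * exp (- \<nu> * n)" for m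
      unfolding u_def using trunc_hom[OF y] trunc_hom[OF z]
    proof (intro tau_dist)
      fix k assume "k \<in> diff (trunc m y) (trunc m z)"
      then have "k \<in> diff y z"
        by (auto simp: diff_def trunc_def split: if_splits)
      then show "real n \<le> real (len k)"
        using far by simp
    qed auto
    then have "d (b y) (b z) \<le> K * exp (- \<nu> * n)"
      using H.conv_dist[OF b[OF y] b[OF z]] by (intro LIMSEQ_le_const2) auto
    then show "d (b y) (b z) \<le> K * exp (- \<nu>) ^ n"
      by (simp add: exp_of_nat_mult[symmetric] algebra_simps)
  qed (use K in auto)
  have key: "c v y = inv\<^bsub>H\<^esub> b (act v y) \<otimes>\<^bsub>H\<^esub> c v x0 \<otimes>\<^bsub>H\<^esub> b y" if v: "v \<in> V" and y: "y \<in> X" for v y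
  proof -
    have vG: "v \<in> carrier G"
      using v V by blast
    obtain g where g: "g \<in> carrier G" "asymp g0 g" "direction (inv v \<otimes> g \<otimes> v)"
        "asymp g0 (inv v \<otimes> g \<otimes> v)"
      using dirs[OF v] by blast
    have vy: "act v y \<in> X"
      using vG y by simp
    have vtr: "homoclinic x0 (act v (trunc n y))" for n
      using homoclinic_act[OF vG trunc_hom[OF y]] act_x0[OF vG] by simp
    have eq: "u y n = inv\<^bsub>H\<^esub> c v x0 \<otimes>\<^bsub>H\<^esub> tau g0 x0 (act v (trunc n y)) \<otimes>\<^bsub>H\<^esub> c v (trunc n y)" for n
      unfolding u_def using tau_equivariant[OF g0 g(1,2) vG g(3,4) trunc_hom[OF y]] act_x0[OF vG] by simp
    \<comment> \<open>Truncation does not commute with the action of \<open>v\<close>, but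
      truncating before or after it gives configurations that differ only at sites of length at
      least \<open>n - len v\<close>.\<close>
    have lim1: "H.conv (\<lambda>n. tau g0 x0 (act v (trunc n y))) (b (act v y))"
    proof (rule H.conv_asymp[OF b[OF vy]])
      show "range (\<lambda>n. tau g0 x0 (act v (trunc n y))) \<subseteq> carrier H"
        using vtr g0 by auto
      have "(\<lambda>n. K * exp (\<nu> * len v) * exp (- \<nu>) ^ n) \<longlonglongrightarrow> K * exp (\<nu> * len v) * 0"
        using K by (intro tendsto_mult_left LIMSEQ_realpow_zero) auto
      then have lim: "(\<lambda>n. K * exp (\<nu> * len v) * exp (- \<nu>) ^ n) \<longlonglongrightarrow> 0"
        by simp
      have "norm (d (u (act v y) n) (tau g0 x0 (act v (trunc n y)))) \<le> K * exp (\<nu> * len v) * exp (- \<nu>) ^ n" for n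
      proof -
        \<comment> \<open>Subtraction of naturals keeps the bound nonnegative, as
          \<open>tau_dist\<close> demands; passing to real subtraction afterwards only weakens the
          estimate.\<close>
        have "d (u (act v y) n) (tau g0 x0 (act v (trunc n y))) \<le> K * exp (- \<nu> * real (n - len v))"
          unfolding u_def using trunc_hom[OF vy] vtr
        proof (intro tau_dist)
          fix k assume k: "k \<in> diff (trunc n (act v y)) (act v (trunc n y))"
          then have kG: "k \<in> carrier G" by (simp add: diff_def)
          have "n < len k \<or> n < len (inv v \<otimes> k)"
            using k vG by (auto simp: diff_def trunc_def act_apply split: if_splits)
          moreover have "len (inv v \<otimes> k) \<le> len v + len k"
            using len_mult_le[of "inv v" k] vG kG by (simp add: len_inv)
          ultimately have "n - len v \<le> len k"
            by linarith
          then show "real (n - len v) \<le> real (len k)"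
            by simp
        qed auto
        also have "\<dots> \<le> K * exp (- \<nu> * (real n - len v))"
          using K by (intro mult_left_mono) auto
        also have "\<dots> = K * exp (\<nu> * len v) * exp (- \<nu>) ^ n"
          by (simp add: exp_of_nat_mult[symmetric] exp_add[symmetric] algebra_simps)
        finally show ?thesis
          by simp
      qed
      then show "(\<lambda>n. d (u (act v y) n) (tau g0 x0 (act v (trunc n y)))) \<longlonglongrightarrow> 0"
        by (intro Lim_null_comparison[OF _ lim] always_eventually allI)
    qed
    have lim2: "H.conv (\<lambda>n. c v (trunc n y)) (c v y)"
    proof (rule H.conv_asymp[OF H.conv_const])
      have "holder_continuous G S A H d (c v)"
        using vG holder by (simp add: holder_cocycle_def)
      from holder_exp[OF this] obtain C \<mu> :: real where C: "0 < C" "0 < \<mu>" and C\<mu>: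
        "\<And>x y (t::real). x \<in> X \<Longrightarrow> y \<in> X \<Longrightarrow> (\<And>k. k \<in> diff x y \<Longrightarrow> t \<le> len k)
           \<Longrightarrow> d (c v x) (c v y) \<le> C * exp (- \<mu> * t)"
        by blast
      have "norm (d (c v y) (c v (trunc n y))) \<le> C * exp (- \<mu>) ^ n" for n
      proof -
        have "d (c v y) (c v (trunc n y)) \<le> C * exp (- \<mu> * n)"
          using y trunc_X[OF y] by (intro C\<mu>) (auto simp: diff_def trunc_def split: if_splits)
        then show ?thesis
          by (simp add: exp_of_nat_mult[symmetric] algebra_simps)
      qed
      moreover have "(\<lambda>n. C * exp (- \<mu>) ^ n) \<longlonglongrightarrow> C * 0"
        using C by (intro tendsto_mult_left LIMSEQ_realpow_zero) auto
      then have "(\<lambda>n. C * exp (- \<mu>) ^ n) \<longlonglongrightarrow> 0"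
        by simp
      ultimately show "(\<lambda>n. d (c v y) (c v (trunc n y))) \<longlonglongrightarrow> 0"
        by (intro Lim_null_comparison[of "\<lambda>n. d (c v y) (c v (trunc n y))" "\<lambda>n. C * exp (- \<mu>) ^ n"]
            always_eventually allI)
    qed (use vG y trunc_X in auto)
    have "H.conv (u y) (inv\<^bsub>H\<^esub> c v x0 \<otimes>\<^bsub>H\<^esub> b (act v y) \<otimes>\<^bsub>H\<^esub> c v y)"
      unfolding eq[abs_def] using vG x0 by (intro H.conv_mult H.conv_const lim1 lim2) auto
    then have "b y = inv\<^bsub>H\<^esub> c v x0 \<otimes>\<^bsub>H\<^esub> b (act v y) \<otimes>\<^bsub>H\<^esub> c v y"
      by (rule H.conv_unique[OF b[OF y]])
    then have "inv\<^bsub>H\<^esub> b (act v y) \<otimes>\<^bsub>H\<^esub> c v x0 \<otimes>\<^bsub>H\<^esub> b y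
        = inv\<^bsub>H\<^esub> b (act v y) \<otimes>\<^bsub>H\<^esub> (c v x0 \<otimes>\<^bsub>H\<^esub> inv\<^bsub>H\<^esub> c v x0) \<otimes>\<^bsub>H\<^esub> b (act v y) \<otimes>\<^bsub>H\<^esub> c v y"
      using vG y x0 bH[OF vy] by (simp only: H.m_assoc H.m_closed H.inv_closed c_closed)
    then show ?thesis
      using vG y x0 bH[OF vy] by simp
  qed
  \<comment> \<open>Both sides are cocycles in \<open>h\<close>: in a product the factors at the
    intermediate point \<open>act h' y\<close> cancel.\<close>
  have word: "\<forall>y\<in>X. c h y = inv\<^bsub>H\<^esub> b (act h y) \<otimes>\<^bsub>H\<^esub> c h x0 \<otimes>\<^bsub>H\<^esub> b y"
    if "set w \<subseteq> V" "h = foldr (\<otimes>) w \<one>" for w h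
    using that
  proof (induction w arbitrary: h)
    case Nil
    then show ?case
      using x0 bH by simp
  next
    case (Cons v w)
    define h' where "h' = foldr (\<otimes>) w \<one>"
    have h: "h = v \<otimes> h'" and vG: "v \<in> carrier G" and v: "v \<in> V" and h'G: "h' \<in> carrier G"
      using Cons.prems V foldr_mult_closed[of w] by (auto simp: h'_def)
    show ?case
    proof
      fix y assume y: "y \<in> X"
      have hy: "act h' y \<in> X"
        using h'G y by simp
      have IH: "c h' y = inv\<^bsub>H\<^esub> b (act h' y) \<otimes>\<^bsub>H\<^esub> c h' x0 \<otimes>\<^bsub>H\<^esub> b y"
        using Cons y by (auto simp: h'_def)
      have "c h y = c v (act h' y) \<otimes>\<^bsub>H\<^esub> c h' y"
        unfolding h by (rule c_mult[OF vG h'G y])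
      also have "\<dots> = inv\<^bsub>H\<^esub> b (act v (act h' y)) \<otimes>\<^bsub>H\<^esub> c v x0
          \<otimes>\<^bsub>H\<^esub> (b (act h' y) \<otimes>\<^bsub>H\<^esub> inv\<^bsub>H\<^esub> b (act h' y)) \<otimes>\<^bsub>H\<^esub> c h' x0 \<otimes>\<^bsub>H\<^esub> b y"
        unfolding IH key[OF v hy] using vG h'G y x0 bH hy
        by (simp only: H.m_assoc H.m_closed H.inv_closed c_closed act_closed)
      also have "\<dots> = inv\<^bsub>H\<^esub> b (act v (act h' y)) \<otimes>\<^bsub>H\<^esub> (c v x0 \<otimes>\<^bsub>H\<^esub> c h' x0) \<otimes>\<^bsub>H\<^esub> b y"
        using vG h'G y x0 bH hy by (simp add: H.m_assoc)
      also have "c v x0 \<otimes>\<^bsub>H\<^esub> c h' x0 = c h x0"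
        unfolding h using c_mult[OF vG h'G x0] act_x0[OF h'G] by simp
      also have "act v (act h' y) = act h y"
        unfolding h using act_mult[OF vG h'G] by simp
      finally show "c h y = inv\<^bsub>H\<^esub> b (act h y) \<otimes>\<^bsub>H\<^esub> c h x0 \<otimes>\<^bsub>H\<^esub> b y" .
    qed
  qed
  have "holder_cohomologous G S A H d c (\<lambda>g x. c g x0)"
    unfolding holder_cohomologous_def
  proof (intro exI[of _ b] conjI b_holder ballI)
    fix h y assume "h \<in> carrier G" "y \<in> X"
    moreover obtain w where "set w \<subseteq> V" "h = foldr (\<otimes>) w \<one>"
      using V(2)[OF \<open>h \<in> carrier G\<close>] by blast
    ultimately show "c h y = inv\<^bsub>H\<^esub> b (act h y) \<otimes>\<^bsub>H\<^esub> c h x0 \<otimes>\<^bsub>H\<^esub> b y"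
      using word by blast
  qed
  moreover have "(\<lambda>g. c g x0) \<in> hom G H"
    using x0 by (auto simp: hom_def c_mult act_x0)
  ultimately show ?thesis
    by (intro bexI[of _ "\<lambda>g. c g x0"])
qed

end

section \<open>Right-angled Coxeter groups\<close>

abbreviation racg_rel :: "'v pair_pre_digraph \<Rightarrow> (('v \<times> bool) list \<times> ('v \<times> bool) list) set" where
  "racg_rel \<Gamma> \<equiv> presentation_rel (pverts \<Gamma>)
     ({([(v, True), (v, True)], []) | v. v \<in> pverts \<Gamma>}
      \<union> {([(v, True), (w, True)], [(w, True), (v, True)]) | v w. (v, w) \<in> parcs \<Gamma>})"

definition word_class :: "'v pair_pre_digraph \<Rightarrow> ('v \<times> bool) list \<Rightarrow> ('v \<times> bool) list set" where
  "word_class \<Gamma> u = racg_rel \<Gamma> `` {u}"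

definition racg_gen :: "'v pair_pre_digraph \<Rightarrow> 'v \<Rightarrow> ('v \<times> bool) list set" where
  "racg_gen \<Gamma> v = word_class \<Gamma> [(v, True)]"

lemma carrier_racg: "carrier (racg \<Gamma>) = word_class \<Gamma> ` signed_words (pverts \<Gamma>)"
  by (auto simp: racg_def presented_group_def word_class_def quotient_def)

lemma one_racg: "\<one>\<^bsub>racg \<Gamma>\<^esub> = word_class \<Gamma> []"
  by (simp add: racg_def presented_group_def word_class_def)

lemma word_class_mult:
  "u \<in> signed_words (pverts \<Gamma>) \<Longrightarrow> w \<in> signed_words (pverts \<Gamma>) \<Longrightarrow>
     word_class \<Gamma> u \<otimes>\<^bsub>racg \<Gamma>\<^esub> word_class \<Gamma> w = word_class \<Gamma> (u @ w)"
  unfolding racg_def word_class_def by (rule presented_group_mult)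

lemma word_class_eq: "(u, w) \<in> racg_rel \<Gamma> \<Longrightarrow> word_class \<Gamma> u = word_class \<Gamma> w"
  unfolding word_class_def by (rule equiv_class_eq[OF equiv_presentation_rel])

lemma signed_words_Cons: "(v, e) # u \<in> signed_words V \<longleftrightarrow> v \<in> V \<and> u \<in> signed_words V"
  by (auto simp: signed_words_def)

lemma signed_words_Nil: "[] \<in> signed_words V"
  by (simp add: signed_words_def)

lemma racg_gen_closed: "v \<in> pverts \<Gamma> \<Longrightarrow> racg_gen \<Gamma> v \<in> carrier (racg \<Gamma>)"
  by (auto simp: carrier_racg racg_gen_def signed_words_Cons signed_words_Nil)

lemma racg_gen_square:
  assumes "v \<in> pverts \<Gamma>"
  shows "racg_gen \<Gamma> v \<otimes>\<^bsub>racg \<Gamma>\<^esub> racg_gen \<Gamma> v = \<one>\<^bsub>racg \<Gamma>\<^esub>"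
proof -
  have "([] @ [(v, True), (v, True)] @ [], [] @ [] @ []) \<in> racg_rel \<Gamma>"
    by (rule presentation_rel.relation) (use assms in \<open>auto simp: signed_words_Cons signed_words_Nil\<close>)
  then show ?thesis
    using assms word_class_eq[of "[(v, True), (v, True)]" "[]" \<Gamma>]
    by (simp add: racg_gen_def word_class_mult one_racg signed_words_Cons signed_words_Nil)
qed

lemma racg_gen_commute:
  assumes "(v, w) \<in> parcs \<Gamma>" "v \<in> pverts \<Gamma>" "w \<in> pverts \<Gamma>"
  shows "racg_gen \<Gamma> v \<otimes>\<^bsub>racg \<Gamma>\<^esub> racg_gen \<Gamma> w = racg_gen \<Gamma> w \<otimes>\<^bsub>racg \<Gamma>\<^esub> racg_gen \<Gamma> v"
proof -
  have "([] @ [(v, True), (w, True)] @ [], [] @ [(w, True), (v, True)] @ []) \<in> racg_rel \<Gamma>"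
    by (rule presentation_rel.relation) (use assms in \<open>auto simp: signed_words_Cons signed_words_Nil\<close>)
  then show ?thesis
    using assms word_class_eq[of "[(v, True), (w, True)]" "[(w, True), (v, True)]" \<Gamma>]
    by (simp add: racg_gen_def word_class_mult signed_words_Cons signed_words_Nil)
qed

lemma racg_gen_inv: "v \<in> pverts \<Gamma> \<Longrightarrow> inv\<^bsub>racg \<Gamma>\<^esub> racg_gen \<Gamma> v = racg_gen \<Gamma> v"
  by (rule group.inv_equality[OF group_racg]) (simp_all add: racg_gen_square racg_gen_closed)

text \<open>Signs of letters carry no information, since each generator is its own inverse.\<close>

lemma word_class_letter:
  assumes "v \<in> pverts \<Gamma>"
  shows "word_class \<Gamma> [(v, e)] = racg_gen \<Gamma> v"
proof (cases e)
  case False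
  have "([] @ [(v, False), (v, \<not> False)] @ [], [] @ []) \<in> racg_rel \<Gamma>"
    by (rule presentation_rel.cancel) (use assms in \<open>auto simp: signed_words_Nil\<close>)
  then have "word_class \<Gamma> [(v, False)] \<otimes>\<^bsub>racg \<Gamma>\<^esub> racg_gen \<Gamma> v = \<one>\<^bsub>racg \<Gamma>\<^esub>"
    using assms word_class_eq[of "[(v, False), (v, True)]" "[]" \<Gamma>]
    by (simp add: racg_gen_def word_class_mult one_racg signed_words_Cons signed_words_Nil)
  moreover have "word_class \<Gamma> [(v, False)] \<in> carrier (racg \<Gamma>)"
    using assms by (auto simp: carrier_racg signed_words_Cons signed_words_Nil)
  ultimately have "inv\<^bsub>racg \<Gamma>\<^esub> racg_gen \<Gamma> v = word_class \<Gamma> [(v, False)]"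
    using assms by (intro group.inv_equality[OF group_racg] racg_gen_closed)
  then show ?thesis
    using assms False by (simp add: racg_gen_inv)
qed (simp add: racg_gen_def)

lemma racg_word:
  assumes "h \<in> carrier (racg \<Gamma>)"
  shows "\<exists>w. set w \<subseteq> racg_gen \<Gamma> ` pverts \<Gamma> \<and> foldr (\<otimes>\<^bsub>racg \<Gamma>\<^esub>) w \<one>\<^bsub>racg \<Gamma>\<^esub> = h"
proof -
  have "\<exists>w. set w \<subseteq> racg_gen \<Gamma> ` pverts \<Gamma> \<and> foldr (\<otimes>\<^bsub>racg \<Gamma>\<^esub>) w \<one>\<^bsub>racg \<Gamma>\<^esub> = word_class \<Gamma> u"
    if "u \<in> signed_words (pverts \<Gamma>)" for u
    using that
  proof (induction u)
    case Nil
    then show ?case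
      by (intro exI[of _ "[]"]) (simp add: one_racg)
  next
    case (Cons p u)
    obtain v e where p: "p = (v, e)" by (cases p)
    have v: "v \<in> pverts \<Gamma>" and u: "u \<in> signed_words (pverts \<Gamma>)"
      using Cons.prems by (auto simp: p signed_words_Cons)
    obtain w where w: "set w \<subseteq> racg_gen \<Gamma> ` pverts \<Gamma>"
        "foldr (\<otimes>\<^bsub>racg \<Gamma>\<^esub>) w \<one>\<^bsub>racg \<Gamma>\<^esub> = word_class \<Gamma> u"
      using Cons.IH[OF u] by blast
    have "racg_gen \<Gamma> v \<otimes>\<^bsub>racg \<Gamma>\<^esub> word_class \<Gamma> u = word_class \<Gamma> (p # u)"
      using v u word_class_mult[of "[(v, e)]" \<Gamma> u]
      by (simp add: p word_class_letter signed_words_Cons signed_words_Nil)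
    then show ?case
      using w v by (intro exI[of _ "racg_gen \<Gamma> v # w"]) auto
  qed
  then show ?thesis
    using assms by (auto simp: carrier_racg)
qed

lemma symmetric_generating_set_racg: "symmetric_generating_set (racg \<Gamma>) (racg_gen \<Gamma> ` pverts \<Gamma>)"
proof -
  let ?V = "racg_gen \<Gamma> ` pverts \<Gamma>"
  have V: "?V \<subseteq> carrier (racg \<Gamma>)"
    by (auto intro: racg_gen_closed)
  have "foldr (\<otimes>\<^bsub>racg \<Gamma>\<^esub>) w \<one>\<^bsub>racg \<Gamma>\<^esub> \<in> generate (racg \<Gamma>) ?V" if "set w \<subseteq> ?V" for w
    using that by (induction w) (auto intro: generate.intros)
  then have "carrier (racg \<Gamma>) \<subseteq> generate (racg \<Gamma>) ?V"
    using racg_word by blast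
  then show ?thesis
    using V group.generate_incl[OF group_racg V]
    by (auto simp: symmetric_generating_set_def racg_gen_inv)
qed

text \<open>Folding \<open>W\<^sub>\<Gamma>\<close> onto the infinite dihedral group: \<open>a\<close> and \<open>c\<close> act on the integers as reflections
  whose product is a unit translation, every other vertex acts trivially.\<close>

definition dihedral_letter :: "'v \<Rightarrow> 'v \<Rightarrow> 'v \<Rightarrow> int \<Rightarrow> int" where
  "dihedral_letter a c v t = (if v = a then - t else if v = c then 1 - t else t)"

definition dihedral_word :: "'v \<Rightarrow> 'v \<Rightarrow> ('v \<times> bool) list \<Rightarrow> int \<Rightarrow> int" where
  "dihedral_word a c u = foldr (\<lambda>p. dihedral_letter a c (fst p)) u"

definition dihedral_act :: "'v \<Rightarrow> 'v \<Rightarrow> ('v \<times> bool) list set \<Rightarrow> int \<Rightarrow> int" where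
  "dihedral_act a c g = dihedral_word a c (SOME u. u \<in> g)"

lemma dihedral_word_append: "dihedral_word a c (u @ w) = dihedral_word a c u \<circ> dihedral_word a c w"
  by (simp add: dihedral_word_def fun_eq_iff)

text \<open>Reflections are involutions and letters ignore signs, which settles squares and
  cancellations. As \<open>a\<close> and \<open>c\<close> are not adjacent, the two letters of a
  commutation relation never act by different reflections. Hence the choice of a word in
  \<open>dihedral_act\<close> is harmless.\<close>

lemma dihedral_word_cong:
  assumes "(u, w) \<in> racg_rel \<Gamma>" and "(a, c) \<notin> parcs \<Gamma>" "(c, a) \<notin> parcs \<Gamma>"
  shows "dihedral_word a c u = dihedral_word a c w"
  using assms(1)
proof (induction rule: presentation_rel.induct)
  case (cancel u w s e)
  have "dihedral_word a c [(s, e), (s, \<not> e)] = id"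
    by (auto simp: dihedral_word_def dihedral_letter_def fun_eq_iff)
  then show ?case
    by (simp only: dihedral_word_append) simp
next
  case (relation u w l r)
  have "dihedral_word a c l = dihedral_word a c r"
    using relation(5) assms(2,3)
    by (auto simp: dihedral_word_def dihedral_letter_def fun_eq_iff)
  then show ?case
    by (simp only: dihedral_word_append)
qed simp_all

lemma dihedral_act_word_class:
  assumes "u \<in> signed_words (pverts \<Gamma>)" and "(a, c) \<notin> parcs \<Gamma>" "(c, a) \<notin> parcs \<Gamma>"
  shows "dihedral_act a c (word_class \<Gamma> u) = dihedral_word a c u"
proof -
  have "u \<in> word_class \<Gamma> u"
    using assms(1) by (auto simp: word_class_def intro: presentation_rel.refl)
  then have "(SOME u'. u' \<in> word_class \<Gamma> u) \<in> word_class \<Gamma> u"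
    by (rule someI)
  then show ?thesis
    using dihedral_word_cong[OF _ assms(2,3)] by (simp add: dihedral_act_def word_class_def)
qed

lemma dihedral_act_mult:
  assumes "g \<in> carrier (racg \<Gamma>)" "h \<in> carrier (racg \<Gamma>)"
    and "(a, c) \<notin> parcs \<Gamma>" "(c, a) \<notin> parcs \<Gamma>"
  shows "dihedral_act a c (g \<otimes>\<^bsub>racg \<Gamma>\<^esub> h) = dihedral_act a c g \<circ> dihedral_act a c h"
proof -
  obtain u w where "u \<in> signed_words (pverts \<Gamma>)" "g = word_class \<Gamma> u"
      "w \<in> signed_words (pverts \<Gamma>)" "h = word_class \<Gamma> w"
    using assms by (auto simp: carrier_racg)
  moreover from this have "u @ w \<in> signed_words (pverts \<Gamma>)"
    by (simp add: signed_words_def)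
  ultimately show ?thesis
    using assms(3,4) by (simp add: word_class_mult dihedral_act_word_class dihedral_word_append)
qed

lemma dihedral_act_one:
  "(a, c) \<notin> parcs \<Gamma> \<Longrightarrow> (c, a) \<notin> parcs \<Gamma> \<Longrightarrow> dihedral_act a c \<one>\<^bsub>racg \<Gamma>\<^esub> = id"
  by (simp add: one_racg dihedral_act_word_class signed_words_Nil) (simp add: dihedral_word_def)

lemma dihedral_act_gen:
  "v \<in> pverts \<Gamma> \<Longrightarrow> (a, c) \<notin> parcs \<Gamma> \<Longrightarrow> (c, a) \<notin> parcs \<Gamma> \<Longrightarrow>
     dihedral_act a c (racg_gen \<Gamma> v) = dihedral_letter a c v"
  by (simp add: racg_gen_def dihedral_act_word_class signed_words_Cons signed_words_Nil)
    (simp add: dihedral_word_def)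

lemma dihedral_word_isometry: "\<bar>dihedral_word a c u s - dihedral_word a c u t\<bar> = \<bar>s - t\<bar>"
proof (induction u)
  case (Cons p u)
  have "\<bar>dihedral_letter a c v x - dihedral_letter a c v y\<bar> = \<bar>x - y\<bar>" for v x y
    by (auto simp: dihedral_letter_def)
  then show ?case
    using Cons by (simp add: dihedral_word_def)
qed (simp add: dihedral_word_def)

text \<open>The group acts by isometries of the integers, so the displacement of the origin is
  subadditive. It is the test function fed into \<open>subadditive_le_len\<close>.\<close>

lemma dihedral_act_displacement:
  assumes "g \<in> carrier (racg \<Gamma>)" "h \<in> carrier (racg \<Gamma>)"
    and "(a, c) \<notin> parcs \<Gamma>" "(c, a) \<notin> parcs \<Gamma>"
  shows "nat \<bar>dihedral_act a c (g \<otimes>\<^bsub>racg \<Gamma>\<^esub> h) 0\<bar>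
    \<le> nat \<bar>dihedral_act a c g 0\<bar> + nat \<bar>dihedral_act a c h 0\<bar>"
proof -
  have "\<bar>dihedral_act a c g t - dihedral_act a c g 0\<bar> = \<bar>t - 0\<bar>" for t
    unfolding dihedral_act_def by (rule dihedral_word_isometry)
  from this[of "dihedral_act a c h 0"] show ?thesis
    unfolding dihedral_act_mult[OF assms] by simp
qed

lemma dihedral_act_pow:
  assumes "g \<in> carrier (racg \<Gamma>)" and "(a, c) \<notin> parcs \<Gamma>" "(c, a) \<notin> parcs \<Gamma>"
  shows "dihedral_act a c (g [^]\<^bsub>racg \<Gamma>\<^esub> (n::nat)) = dihedral_act a c g ^^ n"
proof -
  interpret group "racg \<Gamma>" by (rule group_racg)
  show ?thesis
    using assms by (induction n) (simp_all add: dihedral_act_one dihedral_act_mult funpow_swap1 fun_eq_iff del: nat_pow_Suc add: nat_pow_Suc2)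
qed

section \<open>Squares and the quadrants spanned by their diagonals\<close>

definition square :: "'v pair_pre_digraph \<Rightarrow> 'v \<Rightarrow> 'v \<Rightarrow> 'v \<Rightarrow> 'v \<Rightarrow> bool" where
  "square \<Gamma> a b c d \<longleftrightarrow> a \<noteq> c \<and> b \<noteq> d \<and>
     (a, b) \<in> parcs \<Gamma> \<and> (b, c) \<in> parcs \<Gamma> \<and> (c, d) \<in> parcs \<Gamma> \<and> (d, a) \<in> parcs \<Gamma>"

text \<open>Pairs are ordered because \<open>(a, c)\<close> and \<open>(c, a)\<close> stand for
  mutually inverse elements. In a triangle-free graph, related pairs are those to which
  \<open>asymp_commuting\<close> is applied.\<close>

definition diagonal_rel :: "'v pair_pre_digraph \<Rightarrow> (('v \<times> 'v) \<times> ('v \<times> 'v)) set" where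
  "diagonal_rel \<Gamma> = {((a, c), (b, d)) | a b c d. square \<Gamma> a b c d}"

definition racg_pair :: "'v pair_pre_digraph \<Rightarrow> 'v \<Rightarrow> 'v \<Rightarrow> ('v \<times> bool) list set" where
  "racg_pair \<Gamma> a c = racg_gen \<Gamma> a \<otimes>\<^bsub>racg \<Gamma>\<^esub> racg_gen \<Gamma> c"

lemma racg_pair_closed:
  "a \<in> pverts \<Gamma> \<Longrightarrow> c \<in> pverts \<Gamma> \<Longrightarrow> racg_pair \<Gamma> a c \<in> carrier (racg \<Gamma>)"
  using group_racg[of \<Gamma>] by (simp add: racg_pair_def racg_gen_closed group.is_monoid monoid.m_closed)

lemma racg_pair_inv:
  assumes "a \<in> pverts \<Gamma>" "c \<in> pverts \<Gamma>"
  shows "inv\<^bsub>racg \<Gamma>\<^esub> racg_pair \<Gamma> a c = racg_pair \<Gamma> c a"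
  using assms by (simp add: racg_pair_def group.inv_mult_group[OF group_racg] racg_gen_closed racg_gen_inv)

context
  fixes \<Gamma> :: "'v pair_pre_digraph"
  assumes graph: "pair_graph \<Gamma>"
begin

lemma arc_verts: "(a, b) \<in> parcs \<Gamma> \<Longrightarrow> a \<in> pverts \<Gamma> \<and> b \<in> pverts \<Gamma>"
proof -
  interpret pair_graph \<Gamma> by (rule graph)
  show "(a, b) \<in> parcs \<Gamma> \<Longrightarrow> a \<in> pverts \<Gamma> \<and> b \<in> pverts \<Gamma>"
    using arc_fst_in_verts arc_snd_in_verts by fastforce
qed

lemma arc_sym: "(a, b) \<in> parcs \<Gamma> \<Longrightarrow> (b, a) \<in> parcs \<Gamma>"
proof -
  interpret pair_graph \<Gamma> by (rule graph)
  show "(a, b) \<in> parcs \<Gamma> \<Longrightarrow> (b, a) \<in> parcs \<Gamma>"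
    by (rule arcs_symmetric)
qed

lemma arc_neq: "(a, b) \<in> parcs \<Gamma> \<Longrightarrow> a \<noteq> b"
proof -
  interpret pair_graph \<Gamma> by (rule graph)
  show "(a, b) \<in> parcs \<Gamma> \<Longrightarrow> a \<noteq> b"
    using pair_no_loops by fastforce
qed

lemma square_verts:
  assumes "square \<Gamma> a b c d"
  shows "a \<in> pverts \<Gamma>" "b \<in> pverts \<Gamma>" "c \<in> pverts \<Gamma>" "d \<in> pverts \<Gamma>"
  using assms arc_verts by (auto simp: square_def)

lemma square_symmetries:
  assumes "square \<Gamma> a b c d"
  shows "square \<Gamma> b a d c" "square \<Gamma> a d c b"
  using assms arc_sym by (auto simp: square_def)

lemma racg_pair_commute:
  assumes "square \<Gamma> a b c d"
  shows "racg_pair \<Gamma> a c \<otimes>\<^bsub>racg \<Gamma>\<^esub> racg_pair \<Gamma> b d = racg_pair \<Gamma> b d \<otimes>\<^bsub>racg \<Gamma>\<^esub> racg_pair \<Gamma> a c"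
proof -
  interpret group "racg \<Gamma>" by (rule group_racg)
  let ?s = "racg_gen \<Gamma>" and ?m = "(\<otimes>\<^bsub>racg \<Gamma>\<^esub>)"
  note cl = square_verts[OF assms, THEN racg_gen_closed]
  have arcs: "(a, b) \<in> parcs \<Gamma>" "(b, c) \<in> parcs \<Gamma>" "(c, d) \<in> parcs \<Gamma>" "(d, a) \<in> parcs \<Gamma>"
    using assms by (auto simp: square_def)
  have comm: "?m (?s v) (?s w) = ?m (?s w) (?s v)" if "(v, w) \<in> parcs \<Gamma>" for v w
    using that arc_verts by (intro racg_gen_commute) auto
  have lcomm: "?m (?s v) (?m (?s w) z) = ?m (?s w) (?m (?s v) z)"
    if "(v, w) \<in> parcs \<Gamma>" "z \<in> carrier (racg \<Gamma>)" for v w z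
    using that arc_verts comm[OF that(1)] racg_gen_closed[of _ \<Gamma>] by (metis m_assoc)
  have "?m (?m (?s a) (?s c)) (?m (?s b) (?s d)) = ?m (?s a) (?m (?s c) (?m (?s b) (?s d)))"
    using cl by (simp add: m_assoc)
  also have "\<dots> = ?m (?s a) (?m (?s b) (?m (?s c) (?s d)))"
    using lcomm[OF arcs(2) cl(4)] by simp
  also have "\<dots> = ?m (?s b) (?m (?s a) (?m (?s d) (?s c)))"
    using lcomm[OF arcs(1), of "?m (?s c) (?s d)"] comm[OF arcs(3)] cl by simp
  also have "\<dots> = ?m (?m (?s b) (?s d)) (?m (?s a) (?s c))"
    using lcomm[OF arcs(4) cl(3)] cl by (simp add: m_assoc)
  finally show ?thesis
    by (simp add: racg_pair_def)
qed

text \<open>A chord from \<open>a\<close> to \<open>c\<close> would close the triangle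
  \<open>a b c\<close>.\<close>

lemma square_no_diagonal:
  assumes "triangle_free \<Gamma>" "square \<Gamma> a b c d"
  shows "(a, c) \<notin> parcs \<Gamma>" "(c, a) \<notin> parcs \<Gamma>"
  using assms arc_sym unfolding triangle_free_def square_def by blast+

text \<open>Folding along \<open>a\<close> and \<open>c\<close> kills \<open>b\<close> and
  \<open>d\<close> and makes \<open>ac\<close> a unit translation, so the displacement reads off one
  exponent. The second order of factors, applied to the square \<open>b a d c\<close>, reads off the
  other exponent of the same product.\<close>

lemma square_displacement:
  assumes tf: "triangle_free \<Gamma>" and sq: "square \<Gamma> a b c d"
  shows "nat \<bar>dihedral_act a c (racg_pair \<Gamma> b d [^]\<^bsub>racg \<Gamma>\<^esub> (m::nat)
           \<otimes>\<^bsub>racg \<Gamma>\<^esub> racg_pair \<Gamma> a c [^]\<^bsub>racg \<Gamma>\<^esub> (n::nat)) 0\<bar> = n"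
    and "nat \<bar>dihedral_act a c (racg_pair \<Gamma> a c [^]\<^bsub>racg \<Gamma>\<^esub> (n::nat)
           \<otimes>\<^bsub>racg \<Gamma>\<^esub> racg_pair \<Gamma> b d [^]\<^bsub>racg \<Gamma>\<^esub> (m::nat)) 0\<bar> = n"
proof -
  interpret group "racg \<Gamma>" by (rule group_racg)
  note no = square_no_diagonal[OF tf sq]
  note V = square_verts[OF sq]
  have ne: "a \<noteq> c" "b \<noteq> a" "b \<noteq> c" "d \<noteq> a" "d \<noteq> c"
    using sq arc_neq by (auto simp: square_def)
  have "dihedral_act a c (racg_pair \<Gamma> b d) = id"
    unfolding racg_pair_def using V no ne
    by (simp add: dihedral_act_mult racg_gen_closed dihedral_act_gen) (auto simp: dihedral_letter_def fun_eq_iff)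
  then have bd: "dihedral_act a c (racg_pair \<Gamma> b d [^]\<^bsub>racg \<Gamma>\<^esub> m) = id"
    using V no by (simp add: dihedral_act_pow racg_pair_closed)
  have "dihedral_act a c (racg_pair \<Gamma> a c) = (\<lambda>t. t - 1)"
    unfolding racg_pair_def using V no ne
    by (simp add: dihedral_act_mult racg_gen_closed dihedral_act_gen) (auto simp: dihedral_letter_def fun_eq_iff)
  then have "dihedral_act a c (racg_pair \<Gamma> a c [^]\<^bsub>racg \<Gamma>\<^esub> n) = (\<lambda>t. t - 1) ^^ n"
    using V no by (simp add: dihedral_act_pow racg_pair_closed)
  moreover have "((\<lambda>t. t - 1) ^^ n) t = t - int n" for t
    by (induction n) auto
  ultimately have ac: "dihedral_act a c (racg_pair \<Gamma> a c [^]\<^bsub>racg \<Gamma>\<^esub> n) 0 = - int n"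
    by simp
  show "nat \<bar>dihedral_act a c (racg_pair \<Gamma> b d [^]\<^bsub>racg \<Gamma>\<^esub> m
           \<otimes>\<^bsub>racg \<Gamma>\<^esub> racg_pair \<Gamma> a c [^]\<^bsub>racg \<Gamma>\<^esub> n) 0\<bar> = n"
    "nat \<bar>dihedral_act a c (racg_pair \<Gamma> a c [^]\<^bsub>racg \<Gamma>\<^esub> n
           \<otimes>\<^bsub>racg \<Gamma>\<^esub> racg_pair \<Gamma> b d [^]\<^bsub>racg \<Gamma>\<^esub> m) 0\<bar> = n"
    using V no bd ac by (simp_all add: dihedral_act_mult racg_pair_closed)
qed

lemma square_linear_growth:
  assumes tf: "triangle_free \<Gamma>" and sq: "square \<Gamma> a b c d" and S: "fg_group (racg \<Gamma>) S"
  obtains \<epsilon> :: real where "0 < \<epsilon>"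
    "\<And>(m::nat) (n::nat). \<epsilon> * real n \<le> word_length (racg \<Gamma>) S
       (racg_pair \<Gamma> b d [^]\<^bsub>racg \<Gamma>\<^esub> m \<otimes>\<^bsub>racg \<Gamma>\<^esub> racg_pair \<Gamma> a c [^]\<^bsub>racg \<Gamma>\<^esub> n)"
    "\<And>(m::nat) (n::nat). \<epsilon> * real m \<le> word_length (racg \<Gamma>) S
       (racg_pair \<Gamma> b d [^]\<^bsub>racg \<Gamma>\<^esub> m \<otimes>\<^bsub>racg \<Gamma>\<^esub> racg_pair \<Gamma> a c [^]\<^bsub>racg \<Gamma>\<^esub> n)"
proof -
  interpret fg_group "racg \<Gamma>" S by (rule S)
  note no = square_no_diagonal[OF tf sq]
  note sq' = square_symmetries(1)[OF sq]
  note no' = square_no_diagonal[OF tf sq']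
  obtain \<epsilon>\<^sub>1 :: real where e1: "0 < \<epsilon>\<^sub>1" "\<And>g. g \<in> carrier (racg \<Gamma>) \<Longrightarrow> \<epsilon>\<^sub>1 * nat \<bar>dihedral_act a c g 0\<bar> \<le> len g"
    by (rule subadditive_le_len[of "\<lambda>g. nat \<bar>dihedral_act a c g 0\<bar>"])
      (use no in \<open>auto simp: dihedral_act_displacement dihedral_act_one\<close>)
  obtain \<epsilon>\<^sub>2 :: real where e2: "0 < \<epsilon>\<^sub>2" "\<And>g. g \<in> carrier (racg \<Gamma>) \<Longrightarrow> \<epsilon>\<^sub>2 * nat \<bar>dihedral_act b d g 0\<bar> \<le> len g"
    by (rule subadditive_le_len[of "\<lambda>g. nat \<bar>dihedral_act b d g 0\<bar>"])
      (use no' in \<open>auto simp: dihedral_act_displacement dihedral_act_one\<close>)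
  have cl: "racg_pair \<Gamma> b d [^]\<^bsub>racg \<Gamma>\<^esub> m \<otimes>\<^bsub>racg \<Gamma>\<^esub> racg_pair \<Gamma> a c [^]\<^bsub>racg \<Gamma>\<^esub> n \<in> carrier (racg \<Gamma>)"
    for m n :: nat
    using square_verts[OF sq] by (simp add: racg_pair_closed)
  show ?thesis
  proof (rule that[of "min \<epsilon>\<^sub>1 \<epsilon>\<^sub>2"])
    show "0 < min \<epsilon>\<^sub>1 \<epsilon>\<^sub>2"
      using e1 e2 by simp
    fix m n :: nat
    have "\<epsilon>\<^sub>1 * real n \<le> len (racg_pair \<Gamma> b d [^]\<^bsub>racg \<Gamma>\<^esub> m \<otimes>\<^bsub>racg \<Gamma>\<^esub> racg_pair \<Gamma> a c [^]\<^bsub>racg \<Gamma>\<^esub> n)"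
      using e1(2)[OF cl, of m n] unfolding square_displacement(1)[OF tf sq] .
    then show "min \<epsilon>\<^sub>1 \<epsilon>\<^sub>2 * real n
        \<le> len (racg_pair \<Gamma> b d [^]\<^bsub>racg \<Gamma>\<^esub> m \<otimes>\<^bsub>racg \<Gamma>\<^esub> racg_pair \<Gamma> a c [^]\<^bsub>racg \<Gamma>\<^esub> n)"
      by (rule order_trans[rotated]) (simp add: mult_right_mono)
    have "\<epsilon>\<^sub>2 * real m \<le> len (racg_pair \<Gamma> b d [^]\<^bsub>racg \<Gamma>\<^esub> m \<otimes>\<^bsub>racg \<Gamma>\<^esub> racg_pair \<Gamma> a c [^]\<^bsub>racg \<Gamma>\<^esub> n)"
      using e2(2)[OF cl, of m n] unfolding square_displacement(2)[OF tf sq'] .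
    then show "min \<epsilon>\<^sub>1 \<epsilon>\<^sub>2 * real m
        \<le> len (racg_pair \<Gamma> b d [^]\<^bsub>racg \<Gamma>\<^esub> m \<otimes>\<^bsub>racg \<Gamma>\<^esub> racg_pair \<Gamma> a c [^]\<^bsub>racg \<Gamma>\<^esub> n)"
      by (rule order_trans[rotated]) (simp add: mult_right_mono)
  qed
qed

lemma diagonal_rel_swap:
  assumes "(p, q) \<in> diagonal_rel \<Gamma>"
  shows "(q, p) \<in> diagonal_rel \<Gamma>" "(p, prod.swap q) \<in> diagonal_rel \<Gamma>"
proof -
  obtain a b c d where "p = (a, c)" "q = (b, d)" "square \<Gamma> a b c d"
    using assms by (auto simp: diagonal_rel_def)
  then show "(q, p) \<in> diagonal_rel \<Gamma>" "(p, prod.swap q) \<in> diagonal_rel \<Gamma>"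
    using square_symmetries(1,2)[of a b c d] by (auto simp: diagonal_rel_def)
qed

lemma diagonal_rel_rtrancl_Domain:
  assumes "(p, q) \<in> (diagonal_rel \<Gamma>)\<^sup>*" "p \<in> Domain (diagonal_rel \<Gamma>)"
  shows "q \<in> Domain (diagonal_rel \<Gamma>)"
  using assms diagonal_rel_swap(1) by (induction rule: rtrancl_induct) blast+

text \<open>Two steps inside one square, to a crossing diagonal and back with the orientation
  reversed. In the group this makes a direction asymptotic to its inverse, the hypothesis of
  \<open>tau_bound\<close>.\<close>

lemma diagonal_rel_rtrancl_swap:
  assumes "(p, q) \<in> (diagonal_rel \<Gamma>)\<^sup>*" "p \<in> Domain (diagonal_rel \<Gamma>)"
  shows "(p, prod.swap q) \<in> (diagonal_rel \<Gamma>)\<^sup>*"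
proof -
  obtain r where r: "(q, r) \<in> diagonal_rel \<Gamma>"
    using diagonal_rel_rtrancl_Domain[OF assms] by blast
  then have "(r, prod.swap q) \<in> diagonal_rel \<Gamma>"
    using diagonal_rel_swap by blast
  then show ?thesis
    using assms(1) r by (meson rtrancl.rtrancl_into_rtrancl)
qed

lemma cohomologous_to_hom_of_diagonals:
  assumes tf: "triangle_free \<Gamma>" and sc: "shift_cocycle (racg \<Gamma>) S H d A c"
    and p: "p \<in> Domain (diagonal_rel \<Gamma>)"
    and cover: "\<And>v. v \<in> pverts \<Gamma> \<Longrightarrow> \<exists>w. (p, (v, w)) \<in> (diagonal_rel \<Gamma>)\<^sup>*"
  shows "\<exists>\<phi>\<in>hom (racg \<Gamma>) H. holder_cohomologous (racg \<Gamma>) S A H d c (\<lambda>g x. \<phi> g)"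
proof -
  interpret shift_cocycle "racg \<Gamma>" S H d A c by (rule sc)
  have fg: "fg_group (racg \<Gamma>) S" by unfold_locales
  have pairV: "fst q \<in> pverts \<Gamma> \<and> snd q \<in> pverts \<Gamma>" if "q \<in> Domain (diagonal_rel \<Gamma>)" for q
    using that square_verts by (fastforce simp: diagonal_rel_def)
  define el where "el q = racg_pair \<Gamma> (fst q) (snd q)" for q
  have el: "el q \<in> carrier (racg \<Gamma>)" if "q \<in> Domain (diagonal_rel \<Gamma>)" for q
    using pairV[OF that] by (simp add: el_def racg_pair_closed)
  have dir: "direction (el q)" if q: "q \<in> Domain (diagonal_rel \<Gamma>)" for q
  proof -
    obtain a b c' e where sq: "square \<Gamma> a b c' e" and qe: "q = (a, c')"
      using q by (auto simp: diagonal_rel_def)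
    obtain \<epsilon> :: real where \<epsilon>: "0 < \<epsilon>" "\<And>(m::nat) (n::nat). \<epsilon> * real n \<le> len
       (racg_pair \<Gamma> b e [^]\<^bsub>racg \<Gamma>\<^esub> m \<otimes>\<^bsub>racg \<Gamma>\<^esub> racg_pair \<Gamma> a c' [^]\<^bsub>racg \<Gamma>\<^esub> n)"
      by (rule square_linear_growth[OF tf sq fg]) (rule that)
    \<comment> \<open>The side \<open>m = 0\<close> of the quadrant is the linear growth of a single
      direction.\<close>
    have "\<epsilon> * real n \<le> len (el q [^]\<^bsub>racg \<Gamma>\<^esub> n)" for n :: nat
      using \<epsilon>(2)[of n 0] el[OF q] by (simp add: el_def qe)
    then show ?thesis
      using \<epsilon>(1) el[OF q] by (auto simp: direction_def)
  qed
  have step: "asymp (el q) (el r)" if qr: "(q, r) \<in> diagonal_rel \<Gamma>" for q r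
  proof -
    obtain a b c' e where sq: "square \<Gamma> a b c' e" and qe: "q = (a, c')" "r = (b, e)"
      using qr by (auto simp: diagonal_rel_def)
    obtain \<epsilon> :: real where \<epsilon>: "0 < \<epsilon>" "\<And>(m::nat) (n::nat). \<epsilon> * real n \<le> len
       (racg_pair \<Gamma> b e [^]\<^bsub>racg \<Gamma>\<^esub> m \<otimes>\<^bsub>racg \<Gamma>\<^esub> racg_pair \<Gamma> a c' [^]\<^bsub>racg \<Gamma>\<^esub> n)"
      "\<And>(m::nat) (n::nat). \<epsilon> * real m \<le> len
       (racg_pair \<Gamma> b e [^]\<^bsub>racg \<Gamma>\<^esub> m \<otimes>\<^bsub>racg \<Gamma>\<^esub> racg_pair \<Gamma> a c' [^]\<^bsub>racg \<Gamma>\<^esub> n)"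
      by (rule square_linear_growth[OF tf sq fg]) (rule that)
    show ?thesis
      unfolding el_def qe fst_conv snd_conv
      by (rule asymp_commuting[OF _ _ racg_pair_commute[OF sq] \<epsilon>])
        (use square_verts[OF sq] in \<open>auto intro: racg_pair_closed\<close>)
  qed
  have asy: "asymp (el p) (el q)" if "(p, q) \<in> (diagonal_rel \<Gamma>)\<^sup>*" for q
    using that
  proof (induction rule: rtrancl_induct)
    case base
    show ?case by (rule asymp_refl[OF el[OF p]])
  next
    case (step q r)
    have "q \<in> Domain (diagonal_rel \<Gamma>)" "r \<in> Domain (diagonal_rel \<Gamma>)"
      using step(2) diagonal_rel_swap(1) by blast+
    then show ?case
      using asymp_trans[OF step(3) \<open>\<And>r q. (q, r) \<in> diagonal_rel \<Gamma> \<Longrightarrow> asymp (el q) (el r)\<close>[OF step(2)]]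
        el p by blast
  qed
  have el_swap: "el (prod.swap q) = inv\<^bsub>racg \<Gamma>\<^esub> el q" if "q \<in> Domain (diagonal_rel \<Gamma>)" for q
    using pairV[OF that] by (simp add: el_def racg_pair_inv)
  show ?thesis
  proof (rule cohomologous_to_hom[of "el p" "racg_gen \<Gamma> ` pverts \<Gamma>"])
    show "direction (el p)"
      by (rule dir[OF p])
    show "asymp (el p) (inv\<^bsub>racg \<Gamma>\<^esub> el p)"
      using asy[OF diagonal_rel_rtrancl_swap[OF rtrancl.rtrancl_refl p]] el_swap[OF p] by simp
    show "racg_gen \<Gamma> ` pverts \<Gamma> \<subseteq> carrier (racg \<Gamma>)"
      by (auto intro: racg_gen_closed)
    show "\<exists>w. set w \<subseteq> racg_gen \<Gamma> ` pverts \<Gamma> \<and> foldr (\<otimes>\<^bsub>racg \<Gamma>\<^esub>) w \<one>\<^bsub>racg \<Gamma>\<^esub> = h"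
      if "h \<in> carrier (racg \<Gamma>)" for h
      by (rule racg_word[OF that])
    fix s assume "s \<in> racg_gen \<Gamma> ` pverts \<Gamma>"
    then obtain v where v: "v \<in> pverts \<Gamma>" "s = racg_gen \<Gamma> v" by blast
    obtain w where w: "(p, (v, w)) \<in> (diagonal_rel \<Gamma>)\<^sup>*"
      using cover[OF v(1)] by blast
    then have w': "(p, (w, v)) \<in> (diagonal_rel \<Gamma>)\<^sup>*"
      using diagonal_rel_rtrancl_swap[OF w p] by simp
    have dom: "(v, w) \<in> Domain (diagonal_rel \<Gamma>)" "(w, v) \<in> Domain (diagonal_rel \<Gamma>)"
      using diagonal_rel_rtrancl_Domain[OF _ p] w w' by blast+
    have "w \<in> pverts \<Gamma>"
      using pairV[OF dom(1)] by simp
    then have "inv\<^bsub>racg \<Gamma>\<^esub> s \<otimes>\<^bsub>racg \<Gamma>\<^esub> el (v, w) \<otimes>\<^bsub>racg \<Gamma>\<^esub> s = el (w, v)"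
      using v by (simp add: el_def racg_pair_def racg_gen_closed m_assoc[symmetric])
    then show "\<exists>g\<in>carrier (racg \<Gamma>). asymp (el p) g
        \<and> direction (inv\<^bsub>racg \<Gamma>\<^esub> s \<otimes>\<^bsub>racg \<Gamma>\<^esub> g \<otimes>\<^bsub>racg \<Gamma>\<^esub> s)
        \<and> asymp (el p) (inv\<^bsub>racg \<Gamma>\<^esub> s \<otimes>\<^bsub>racg \<Gamma>\<^esub> g \<otimes>\<^bsub>racg \<Gamma>\<^esub> s)"
      using asy[OF w] asy[OF w'] dir[OF dom(2)] el[OF dom(1)]
      by (intro bexI[of _ "el (v, w)"]) simp_all
  qed
qed

end

section \<open>Diagonals of four-cycles\<close>

text \<open>Expressed through the edge set \<open>C\<close> itself, so that no cyclic labelling has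
  to be chosen when two four-cycles are compared.\<close>

definition diagonals :: "'v set set \<Rightarrow> ('v \<times> 'v) set" where
  "diagonals C = {(v, w). v \<noteq> w \<and> v \<in> \<Union>C \<and> w \<in> \<Union>C \<and> {v, w} \<notin> C}"

lemma four_cycle_diagonals:
  assumes "C \<in> four_cycles \<Gamma>"
  obtains a b c d where "square \<Gamma> a b c d" "distinct [a, b, c, d]"
    "C = {{a, b}, {b, c}, {c, d}, {d, a}}" "diagonals C = {(a, c), (c, a), (b, d), (d, b)}"
proof -
  obtain a b c d where *: "distinct [a, b, c, d]" "C = {{a, b}, {b, c}, {c, d}, {d, a}}"
      "(a, b) \<in> parcs \<Gamma>" "(b, c) \<in> parcs \<Gamma>" "(c, d) \<in> parcs \<Gamma>" "(d, a) \<in> parcs \<Gamma>"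
    using assms by (auto simp: four_cycles_def)
  have "diagonals C = {(a, c), (c, a), (b, d), (d, b)}"
    using *(1) unfolding diagonals_def *(2) by (auto simp: doubleton_eq_iff)
  with * show ?thesis
    by (intro that[of a b c d]) (auto simp: square_def)
qed

text \<open>The unshared endpoints of two adjacent edges are opposite in the cycle. Their symmetric
  difference does not mention the cycle, so all four-cycles through both edges have this diagonal in
  common.\<close>

lemma adjacent_edges_diagonal:
  assumes "C \<in> four_cycles \<Gamma>" "e \<in> C" "f \<in> C" "e \<noteq> f" "e \<inter> f \<noteq> {}"
  shows "\<exists>v w. (e \<union> f) - (e \<inter> f) = {v, w} \<and> v \<noteq> w"
    and "\<lbrakk>(e \<union> f) - (e \<inter> f) = {v, w}; v \<noteq> w\<rbrakk> \<Longrightarrow> (v, w) \<in> diagonals C"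
proof -
  obtain a b c d where C: "distinct [a, b, c, d]"
    "C = {{a, b}, {b, c}, {c, d}, {d, a}}" "diagonals C = {(a, c), (c, a), (b, d), (d, b)}"
    using four_cycle_diagonals[OF assms(1)] by metis
  have "(e \<union> f) - (e \<inter> f) = {a, c} \<or> (e \<union> f) - (e \<inter> f) = {b, d}"
    using assms(2-) C(1) unfolding C(2) by auto
  then show "\<exists>v w. (e \<union> f) - (e \<inter> f) = {v, w} \<and> v \<noteq> w"
    and "\<lbrakk>(e \<union> f) - (e \<inter> f) = {v, w}; v \<noteq> w\<rbrakk> \<Longrightarrow> (v, w) \<in> diagonals C"
    using C(1,3) by (auto simp: doubleton_eq_iff)
qed

lemma adjacent_four_cycles_diagonal:
  assumes "(C, D) \<in> parcs (four_cycle_graph \<Gamma>)"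
  obtains p where "p \<in> diagonals C" "p \<in> diagonals D"
proof -
  obtain e f where *: "C \<in> four_cycles \<Gamma>" "D \<in> four_cycles \<Gamma>" "e \<in> C" "e \<in> D" "f \<in> C" "f \<in> D"
      "e \<noteq> f" "e \<inter> f \<noteq> {}"
    using assms by (auto simp: four_cycle_graph_def)
  then obtain v w where "(e \<union> f) - (e \<inter> f) = {v, w}" "v \<noteq> w"
    using adjacent_edges_diagonal(1)[of C \<Gamma> e f] by blast
  then have "(v, w) \<in> diagonals C" "(v, w) \<in> diagonals D"
    using * adjacent_edges_diagonal(2)[of _ \<Gamma> e f] by blast+
  then show ?thesis by (rule that)
qed

lemma square_diagonal_rel: "square \<Gamma> a b c d \<Longrightarrow> ((a, c), (b, d)) \<in> diagonal_rel \<Gamma>"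
  by (auto simp: diagonal_rel_def)

text \<open>Crossing diagonals are related directly, in every orientation; equal or reversed ones
  are linked through a crossing one.\<close>

lemma four_cycle_diagonals_related:
  assumes graph: "pair_graph \<Gamma>" and C: "C \<in> four_cycles \<Gamma>" and pq: "p \<in> diagonals C" "q \<in> diagonals C"
  shows "(p, q) \<in> (diagonal_rel \<Gamma>)\<^sup>*" and "p \<in> Domain (diagonal_rel \<Gamma>)"
proof -
  obtain a b c d where sq: "square \<Gamma> a b c d" and diag: "diagonals C = {(a, c), (c, a), (b, d), (d, b)}"
    using four_cycle_diagonals[OF C] by metis
  have rel: "((a, c), (b, d)) \<in> diagonal_rel \<Gamma>"
    by (rule square_diagonal_rel[OF sq])
  note swap = diagonal_rel_swap[OF graph]
  note all = rel swap(1)[OF rel] swap(2)[OF rel, simplified] swap(2)[OF swap(1)[OF rel], simplified]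
  note all' = all swap(1)[OF all(3)] swap(1)[OF all(4)]
  have cross: "(r, s) \<in> diagonal_rel \<Gamma> \<and> (s, r) \<in> diagonal_rel \<Gamma>"
    if "r \<in> {(a, c), (c, a)}" "s \<in> {(b, d), (d, b)}" for r s
    using that all' swap(2)[OF all'(6), simplified] swap(1)[OF swap(2)[OF all'(6), simplified]] by auto
  show "p \<in> Domain (diagonal_rel \<Gamma>)"
    using pq(1) cross unfolding diag by blast
  consider "p \<in> {(a, c), (c, a)}" "q \<in> {(a, c), (c, a)}" | "p \<in> {(a, c), (c, a)}" "q \<in> {(b, d), (d, b)}"
    | "p \<in> {(b, d), (d, b)}" "q \<in> {(a, c), (c, a)}" | "p \<in> {(b, d), (d, b)}" "q \<in> {(b, d), (d, b)}"
    using pq unfolding diag by blast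
  then show "(p, q) \<in> (diagonal_rel \<Gamma>)\<^sup>*"
  proof cases
    case 1
    then show ?thesis
      using cross[of p "(b, d)"] cross[of q "(b, d)"] by (meson insertI1 r_into_rtrancl rtrancl_trans)
  next
    case 4
    then show ?thesis
      using cross[of "(a, c)" p] cross[of "(a, c)" q] by (meson insertI1 r_into_rtrancl rtrancl_trans)
  qed (use cross in blast)+
qed

section \<open>Chains of diagonals covering the graph\<close>

text \<open>The common form in which joins and CFS graphs enter
  \<open>cohomologous_to_hom_of_diagonals\<close>.\<close>

definition diagonally_connected :: "'v pair_pre_digraph \<Rightarrow> bool" where
  "diagonally_connected \<Gamma> \<longleftrightarrow> (\<exists>p \<in> Domain (diagonal_rel \<Gamma>).
     \<forall>v \<in> pverts \<Gamma>. \<exists>w. (p, (v, w)) \<in> (diagonal_rel \<Gamma>)\<^sup>*)"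

lemma CFS_diagonally_connected:
  assumes graph: "pair_graph \<Gamma>" and "CFS \<Gamma>"
  shows "diagonally_connected \<Gamma>"
proof -
  let ?F = "with_proj (four_cycle_graph \<Gamma>)"
  obtain K where K: "K \<in> pre_digraph.sccs_verts ?F" and supp: "support K = pverts \<Gamma>"
    using assms(2) by (auto simp: CFS_def)
  then have "K \<noteq> {}" and reach: "\<And>C D. C \<in> K \<Longrightarrow> D \<in> K \<Longrightarrow> C \<rightarrow>\<^sup>*\<^bsub>?F\<^esub> D"
    by (auto simp: pre_digraph.sccs_verts_def)
  then obtain C0 where C0: "C0 \<in> K"
    by blast
  \<comment> \<open>Reachability from \<open>C\<close> to itself includes membership in the vertex
    set of the four-cycle graph.\<close>
  have cycle: "C \<in> four_cycles \<Gamma>" if "C \<in> K" for C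
    using reach[OF that that] by (auto simp: reachable_def four_cycle_graph_def dest: in_rtrancl_on_in_F)
  obtain p where p: "p \<in> diagonals C0"
    using four_cycle_diagonals[OF cycle[OF C0]] by (metis insertI1)
  have related: "\<forall>q\<in>diagonals C. (p, q) \<in> (diagonal_rel \<Gamma>)\<^sup>*" if "C \<in> K" for C
  proof -
    have "(C0, C) \<in> rtrancl_on (four_cycles \<Gamma>) (parcs (four_cycle_graph \<Gamma>))"
      using reach[OF C0 that] by (simp add: reachable_def four_cycle_graph_def)
    then show ?thesis
    proof (induction rule: rtrancl_on_induct)
      case base
      then show ?case
        using four_cycle_diagonals_related(1)[OF graph base p] by blast
    next
      case (step C D)
      obtain r where "r \<in> diagonals C" "r \<in> diagonals D"
        using adjacent_four_cycles_diagonal[OF step(2)] .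
      then show ?case
        using step four_cycle_diagonals_related(1)[OF graph \<open>D \<in> four_cycles \<Gamma>\<close>, of r]
        by (meson rtrancl_trans)
    qed
  qed
  have "\<exists>w. (p, (v, w)) \<in> (diagonal_rel \<Gamma>)\<^sup>*" if "v \<in> pverts \<Gamma>" for v
  proof -
    have "v \<in> support K"
      using that supp by simp
    then obtain C where C: "C \<in> K" "v \<in> \<Union>C"
      unfolding support_def by blast
    obtain a b c d where "C = {{a, b}, {b, c}, {c, d}, {d, a}}"
        "diagonals C = {(a, c), (c, a), (b, d), (d, b)}"
      using four_cycle_diagonals[OF cycle[OF C(1)]] by metis
    then have "\<exists>w. (v, w) \<in> diagonals C"
      using C(2) by auto
    then show ?thesis
      using related[OF C(1)] by blast
  qed
  then show ?thesis
    using four_cycle_diagonals_related(2)[OF graph cycle[OF C0] p p] by (auto simp: diagonally_connected_def)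
qed

lemma connected_restrict_arc:
  assumes conn: "Digraph_Component.connected (with_proj \<Gamma> \<restriction> U)" and U: "u \<in> U" "v \<in> U" "u \<noteq> v"
  shows "\<exists>x\<in>U. (u, x) \<in> parcs \<Gamma> \<or> (x, u) \<in> parcs \<Gamma>"
proof -
  have "u \<rightarrow>\<^sup>*\<^bsub>with_proj (mk_symmetric (with_proj \<Gamma> \<restriction> U))\<^esub> v"
    using conn U by (simp add: connected_def strongly_connected_def)
  then have "(u, v) \<in> (parcs (mk_symmetric (with_proj \<Gamma> \<restriction> U)))\<^sup>*"
    by (auto dest: reachable_rtranclI)
  then obtain x where "(u, x) \<in> parcs (mk_symmetric (with_proj \<Gamma> \<restriction> U))"
    using U(3) by (meson converse_rtranclE)
  then show ?thesis
    by (auto simp: parcs_mk_symmetric induce_subgraph_def)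
qed

text \<open>With a single vertex \<open>x\<close> on one side the graph is a star. A star with at
  least two leaves is disconnected by removing \<open>x\<close>, and a star with one leaf is a
  single edge.\<close>

lemma bipartite_side_not_singleton:
  assumes X: "x \<in> X" and Y: "Y \<noteq> {}" "X \<inter> Y = {}" and verts: "pverts \<Gamma> = X \<union> Y"
    and arcs: "parcs \<Gamma> = X \<times> Y \<union> Y \<times> X"
    and sep: "\<not> (\<exists>v. separating_vertex \<Gamma> v)" "\<not> (\<exists>v w. separating_edge \<Gamma> v w)"
  shows "\<exists>x'\<in>X. x' \<noteq> x"
proof (rule ccontr)
  assume "\<not> ?thesis"
  then have X1: "X = {x}"
    using X by blast
  obtain y where y: "y \<in> Y"
    using Y by blast
  have "Digraph_Component.connected (with_proj \<Gamma> \<restriction> (pverts \<Gamma> - {x, y}))"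
    using sep(2) y X by (auto simp: separating_edge_def arcs)
  \<comment> \<open>The empty graph counts as not connected, so removing the edge must leave a
    vertex; this rules out the single edge.\<close>
  then have "pverts \<Gamma> - {x, y} \<noteq> {}"
    by (simp add: connected_def strongly_connected_def)
  then obtain y' where y': "y' \<in> Y" "y' \<noteq> y"
    by (auto simp: verts X1)
  have "Digraph_Component.connected (with_proj \<Gamma> \<restriction> (pverts \<Gamma> - {x}))"
    using sep(1) X by (auto simp: separating_vertex_def verts)
  moreover have "pverts \<Gamma> - {x} = Y"
    using Y by (auto simp: verts X1)
  ultimately show False
    using connected_restrict_arc[of \<Gamma> Y y y'] y y' Y by (auto simp: arcs)
qed

text \<open>With two vertices on each side, any two vertices of \<open>X\<close> and any two of
  \<open>Y\<close> are the diagonals of a square, so at most two steps reach every vertex.\<close>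

lemma bipartite_diagonally_connected:
  assumes bip: "complete_bipartite_graph \<Gamma>"
    and sep: "\<not> (\<exists>v. separating_vertex \<Gamma> v)" "\<not> (\<exists>v w. separating_edge \<Gamma> v w)"
  shows "diagonally_connected \<Gamma>"
proof -
  obtain X Y where XY: "X \<noteq> {}" "Y \<noteq> {}" "X \<inter> Y = {}" "pverts \<Gamma> = X \<union> Y"
      "parcs \<Gamma> = X \<times> Y \<union> Y \<times> X"
    using bip by (auto simp: complete_bipartite_graph_def)
  have otherX: "\<exists>x'\<in>X. x' \<noteq> x" if "x \<in> X" for x
    using bipartite_side_not_singleton[OF that XY(2-5) sep] .
  have otherY: "\<exists>y'\<in>Y. y' \<noteq> y" if "y \<in> Y" for y
    by (rule bipartite_side_not_singleton[OF that XY(1) _ _ _ sep]) (use XY in auto)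
  have rel: "((x, x'), (y, y')) \<in> diagonal_rel \<Gamma>" "((y, y'), (x, x')) \<in> diagonal_rel \<Gamma>"
    if "x \<in> X" "x' \<in> X" "x \<noteq> x'" "y \<in> Y" "y' \<in> Y" "y \<noteq> y'" for x x' y y'
    using that by (auto intro!: square_diagonal_rel simp: square_def XY(5))
  obtain x where x: "x \<in> X"
    using XY by blast
  obtain x' where x': "x' \<in> X" "x' \<noteq> x"
    using otherX[OF x] by blast
  obtain y where y: "y \<in> Y"
    using XY by blast
  obtain y' where y': "y' \<in> Y" "y' \<noteq> y"
    using otherY[OF y] by blast
  have "\<exists>w. ((x, x'), (v, w)) \<in> (diagonal_rel \<Gamma>)\<^sup>*" if "v \<in> pverts \<Gamma>" for v
  proof (cases "v \<in> X")
    case True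
    then obtain w where "w \<in> X" "w \<noteq> v"
      using otherX by blast
    then have "((x, x'), (y, y')) \<in> diagonal_rel \<Gamma>" "((y, y'), (v, w)) \<in> diagonal_rel \<Gamma>"
      using rel True x x' y y' by metis+
    then show ?thesis
      by (meson r_into_rtrancl rtrancl.rtrancl_into_rtrancl)
  next
    case False
    then have "v \<in> Y"
      using that XY by blast
    then obtain w where "w \<in> Y" "w \<noteq> v"
      using otherY by blast
    then have "((x, x'), (v, w)) \<in> diagonal_rel \<Gamma>"
      using rel \<open>v \<in> Y\<close> x x' by metis
    then show ?thesis
      by blast
  qed
  moreover have "(x, x') \<in> Domain (diagonal_rel \<Gamma>)"
    using rel x x' y y' by (metis DomainI)
  ultimately show ?thesis
    by (auto simp: diagonally_connected_def)
qed

theorem mainTheorem6: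
  fixes \<Gamma> :: "'v pair_pre_digraph"
  assumes "pair_graph \<Gamma>"
    and "Digraph_Component.connected (with_proj \<Gamma>)"
    and "triangle_free \<Gamma>"
    and "\<not> (\<exists>v. separating_vertex \<Gamma> v)"
    and "\<not> (\<exists>v w. separating_edge \<Gamma> v w)"
    and "complete_bipartite_graph \<Gamma> \<or> CFS \<Gamma>"
    and "infinite (carrier (racg \<Gamma>))"
  shows "class_G_H TYPE('a) TYPE('h) (racg \<Gamma>)"
proof -
  have "diagonally_connected \<Gamma>"
    using assms(6) CFS_diagonally_connected[OF assms(1)] bipartite_diagonally_connected[OF _ assms(4,5)]
    by blast
  then obtain p where p: "p \<in> Domain (diagonal_rel \<Gamma>)"
      "\<And>v. v \<in> pverts \<Gamma> \<Longrightarrow> \<exists>w. (p, (v, w)) \<in> (diagonal_rel \<Gamma>)\<^sup>*"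
    by (auto simp: diagonally_connected_def)
  show ?thesis
    unfolding class_G_H_def
  proof (intro conjI allI impI group_racg)
    have "finite (pverts \<Gamma>)"
      using assms(1) by (simp add: pair_graph_def pair_digraph_def pair_fin_digraph_def pair_fin_digraph_axioms_def)
    then show "\<exists>S. finite S \<and> symmetric_generating_set (racg \<Gamma>) S"
      using symmetric_generating_set_racg by blast
    fix S and A :: "'a set" and H :: "'h monoid" and T d c
    assume *: "finite S \<and> symmetric_generating_set (racg \<Gamma>) S \<and> finite A
          \<and> G_inv H T \<and> biinvariant_metric H T d \<and> Metric_space.mcomplete (carrier H) d
          \<and> holder_cocycle (racg \<Gamma>) S A H d c"
    have "fg_group (racg \<Gamma>) S"
      using * by (intro fg_group.intro fg_group_axioms.intro group_racg) auto
    moreover have "biinvariant_group H d"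
      using * by (intro biinvariant_group.intro biinvariant_group_axioms.intro)
        (auto simp: G_inv_def polish_group_def biinvariant_metric_def)
    ultimately have "shift_cocycle (racg \<Gamma>) S H d A c"
      using * by (intro shift_cocycle.intro shift_cocycle_axioms.intro) auto
    then show "\<exists>\<phi>\<in>hom (racg \<Gamma>) H. holder_cohomologous (racg \<Gamma>) S A H d c (\<lambda>g x. \<phi> g)"
      by (rule cohomologous_to_hom_of_diagonals[OF assms(1,3) _ p])
  qed
qed

end
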